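(* There are absolute constants $\epsilon_0>0$ and $c>0$ such that for every $0<\epsilon<\epsilon_0$ and all positive integers $n,k$ with $nk\ge 2$, any (two-sided error) $\epsilon$-tester for $k$-clusterability in $\mathbb{R}^n$ must have sample complexity at least $c\cdot\frac{nk}{\log(nk)}$.
   Context: For $x\in\mathbb{R}^n$ let $B_1(x)=\{y\in\mathbb{R}^n:\|x-y\|_2\le 1\}$. A probability distribution $\mathcal{D}$ over $\mathbb{R}^n$ is $k$-clusterable if there exist $c_1,\dots,c_k\in\mathbb{R}^n$ with $\mathrm{supp}(\mathcal{D})\subseteq\bigcup_{i=1}^k B_1(c_i)$. It is $\epsilon$-far from $k$-clusterable if its total variation distance to every $k$-clusterable distribution is at least $\epsilon$. An $\epsilon$-tester for $k$-clusterability in $\mathbb{R}^n$ with sample complexity $m$ is a (computationally unbounded) randomized algorithm that, for every unknown probability distribution $\mathcal{D}$ over $\mathbb{R}^n$ (finitely supported distributions included), receives $m$ independent samples from $\mathcal{D}$, outputs $1$ with probability at least $2/3$ if $\mathcal{D}$ is $k$-clusterable, and outputs $0$ with probability at least $2/3$ if $\mathcal{D}$ is $\epsilon$-far from $k$-clusterable. *)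

theory Defs
  imports "HOL-Probability.Probability"
begin

text \<open>
  The dimension is quantified inside the statement, so a point of $R^n$ is an extensional
  function on the index set \<open>{..<n}\<close>; the product sigma-algebra below is the Borel
  sigma-algebra of $R^n$.
\<close>

definition euclid :: "nat \<Rightarrow> (nat \<Rightarrow> real) measure" where
  "euclid n = PiM {..<n} (\<lambda>_. borel)"

definition l2_dist :: "nat \<Rightarrow> (nat \<Rightarrow> real) \<Rightarrow> (nat \<Rightarrow> real) \<Rightarrow> real" where
  "l2_dist n x y = L2_set (\<lambda>i. x i - y i) {..<n}"

definition unit_ball :: "nat \<Rightarrow> (nat \<Rightarrow> real) \<Rightarrow> (nat \<Rightarrow> real) set" where
  "unit_ball n x = {y \<in> space (euclid n). l2_dist n x y \<le> 1}"

definition distribution_on :: "nat \<Rightarrow> (nat \<Rightarrow> real) measure \<Rightarrow> bool" where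
  "distribution_on n D \<longleftrightarrow> prob_space D \<and> sets D = sets (euclid n)"

text \<open>The topological support: the points all of whose neighbourhoods have positive mass.\<close>

definition supp :: "nat \<Rightarrow> (nat \<Rightarrow> real) measure \<Rightarrow> (nat \<Rightarrow> real) set" where
  "supp n D = {x \<in> space (euclid n).
     \<forall>r>0. measure D {y \<in> space (euclid n). l2_dist n x y < r} > 0}"

definition clusterable :: "nat \<Rightarrow> nat \<Rightarrow> (nat \<Rightarrow> real) measure \<Rightarrow> bool" where
  "clusterable n k D \<longleftrightarrow> distribution_on n D \<and>
     (\<exists>c. (\<forall>i<k. c i \<in> space (euclid n)) \<and> supp n D \<subseteq> (\<Union>i<k. unit_ball n (c i)))"

definition tv_dist :: "'a measure \<Rightarrow> 'a measure \<Rightarrow> real" where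
  "tv_dist P Q = (SUP A\<in>sets P. \<bar>measure P A - measure Q A\<bar>)"

definition far_from_clusterable ::
    "nat \<Rightarrow> nat \<Rightarrow> real \<Rightarrow> (nat \<Rightarrow> real) measure \<Rightarrow> bool" where
  "far_from_clusterable n k \<epsilon> D \<longleftrightarrow> distribution_on n D \<and>
     (\<forall>D'. clusterable n k D' \<longrightarrow> tv_dist D D' \<ge> \<epsilon>)"

text \<open>
  A randomized algorithm reading \<open>m\<close> samples is a Markov kernel from \<open>m\<close>-tuples of points
  to output bits; \<open>True\<close> is the output 1. Its internal randomness is thus independent
  of the samples, and no computational restriction is imposed.
\<close>

definition randomized_alg ::
    "nat \<Rightarrow> nat \<Rightarrow> ((nat \<Rightarrow> nat \<Rightarrow> real) \<Rightarrow> bool measure) \<Rightarrow> bool" where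
  "randomized_alg n m T \<longleftrightarrow>
     T \<in> PiM {..<m} (\<lambda>_. euclid n) \<rightarrow>\<^sub>M prob_algebra (count_space UNIV)"

text \<open>The law of the output when the input consists of \<open>m\<close> independent samples from \<open>D\<close>.\<close>

definition output_law ::
    "nat \<Rightarrow> ((nat \<Rightarrow> nat \<Rightarrow> real) \<Rightarrow> bool measure) \<Rightarrow> (nat \<Rightarrow> real) measure \<Rightarrow> bool measure" where
  "output_law m T D = PiM {..<m} (\<lambda>_. D) \<bind> T"

definition is_tester ::
    "nat \<Rightarrow> nat \<Rightarrow> real \<Rightarrow> nat \<Rightarrow> ((nat \<Rightarrow> nat \<Rightarrow> real) \<Rightarrow> bool measure) \<Rightarrow> bool" where
  "is_tester n k \<epsilon> m T \<longleftrightarrow> randomized_alg n m T \<and>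
     (\<forall>D. distribution_on n D \<longrightarrow>
        (clusterable n k D \<longrightarrow> measure (output_law m T D) {True} \<ge> 2/3) \<and>
        (far_from_clusterable n k \<epsilon> D \<longrightarrow> measure (output_law m T D) {False} \<ge> 2/3))"

end

theory Submission
  imports Defs "HOL-Complex_Analysis.Complex_Analysis" "HOL-Real_Asymp.Real_Asymp"
begin

text \<open>
  The proof is a reduction from support size estimation. A group of $4n$ points in $R^n$ has the
  property that any $n$ of them lie in a unit ball while every unit ball contains at most $3n$ of
  them. About $k$ well separated groups give $M = \Theta(nk)$ points. Give these points independent
  random integer weights divided by $M$, and put one further atom of weight 1 at a group centre. If
  nearly all weights vanish, the normalised distribution is $k$-clusterable; if none vanishes and
  the total is $O(1)$, then any $k$ balls miss a constant fraction of the mass.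

  The weights of the first kind and of the second kind can be drawn from two priors on
  $\{0, \dots, O(r^2)\}$ with the same moments up to order $r$. As a function of a single
  unnormalised weight, the acceptance probability of the tester is a rational function which is
  analytic near 0 and bounded by $e^{O(mR)}$ on the disc of radius $R$. Cauchy's estimates with
  $R = \Theta(r^2/M)$ bound the effect of exchanging the two priors in one coordinate by
  $e^{O(m r^2/M)} 2^{-r}$, hence in all of them by $M$ times that, which is small for
  $r = \Theta(\log (nk))$ unless $m$ is at least of order $nk / \log (nk)$.
\<close>

text \<open>The obstacle is that the normaliser depends on all weights at once. Poissonisation would
  decouple the sample counts; here the number of samples stays fixed and a single weight is
  continued to the complex plane, where the only possible pole is minus the sum of the other
  weights. The extra atom keeps it at distance at least 1 from 0. A range of order r^2 for the
  priors is forced: on a shorter range a polynomial of Chebyshev type and degree r, with value 1 at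
  0 and small on the rest of the range, would tell a prior concentrated at 0 from one that avoids 0.
  This range also costs the logarithm: 2^-r beats e^{O(m r^2/M)} only if m r = O(M), while the union
  over M coordinates needs r of order log M. The value 1/4000 for the distance comes from three
  constants: at least a fifth of the M points stay uncovered, each has weight at least 1/M, and the
  total weight is at most 701; 1/3505 of the mass is thus missed.\<close>

subsection \<open>Priors with matching moments\<close>

text \<open>The sum is the divided difference of \<open>x ^ k\<close> on \<open>S\<close>. A factor
  \<open>x - a\<close> cancels against the denominators and deletes the node \<open>a\<close>
  (\<open>drop\<close>). Writing \<open>x = (x - a) + a\<close> lowers the exponent; for exponent 0,
  the constant \<open>b - a\<close> is the difference of \<open>x - a\<close> and
  \<open>x - b\<close>, which removes one node in each term.\<close>

lemma divided_difference_power: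
  fixes S :: "'a::field set"
  assumes "finite S" "S \<noteq> {}" "k < card S"
  shows "(\<Sum>x\<in>S. x ^ k / (\<Prod>y\<in>S - {x}. x - y)) = (if k = card S - 1 then 1 else 0)"
  using assms
proof (induction "card S + k" arbitrary: S k rule: less_induct)
  case less
  have drop: "(\<Sum>x\<in>S. (x - a) * x ^ l / (\<Prod>y\<in>S - {x}. x - y))
      = (\<Sum>x\<in>S - {a}. x ^ l / (\<Prod>y\<in>S - {a} - {x}. x - y))" if "a \<in> S" for a l
  proof -
    have "(\<Sum>x\<in>S. (x - a) * x ^ l / (\<Prod>y\<in>S - {x}. x - y))
        = (\<Sum>x\<in>S - {a}. (x - a) * x ^ l / (\<Prod>y\<in>S - {x}. x - y))"
      using less.prems that by (simp add: sum.remove)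
    also have "\<dots> = (\<Sum>x\<in>S - {a}. x ^ l / (\<Prod>y\<in>S - {a} - {x}. x - y))"
    proof (rule sum.cong[OF refl])
      fix x assume x: "x \<in> S - {a}"
      then have "(\<Prod>y\<in>S - {x}. x - y) = (x - a) * (\<Prod>y\<in>S - {x} - {a}. x - y)"
        using less.prems that by (intro prod.remove) auto
      moreover have "S - {x} - {a} = S - {a} - {x}" by auto
      ultimately show "(x - a) * x ^ l / (\<Prod>y\<in>S - {x}. x - y)
          = x ^ l / (\<Prod>y\<in>S - {a} - {x}. x - y)"
        using x by simp
    qed
    finally show ?thesis .
  qed
  obtain a where a: "a \<in> S" using less.prems by auto
  show ?case
  proof (cases "S = {a}")
    case True
    then show ?thesis using less.prems by simp
  next
    case False
    then obtain b where b: "b \<in> S" "b \<noteq> a" using a by auto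
    have card: "card (S - {a}) = card S - 1" "card (S - {b}) = card S - 1" "card S \<ge> 2"
      using a b less.prems card_le_Suc0_iff_eq[of S] by (auto simp: not_less_eq_eq[symmetric] numeral_2_eq_2)
    show ?thesis
    proof (cases k)
      case 0
      have "(b - a) * (\<Sum>x\<in>S. x ^ k / (\<Prod>y\<in>S - {x}. x - y))
          = (\<Sum>x\<in>S. (x - a) * x ^ 0 / (\<Prod>y\<in>S - {x}. x - y))
            - (\<Sum>x\<in>S. (x - b) * x ^ 0 / (\<Prod>y\<in>S - {x}. x - y))"
        unfolding sum_distrib_left sum_subtractf[symmetric]
        by (rule sum.cong) (simp_all add: 0 diff_divide_distrib)
      also have "\<dots> = 0"
      proof -
        have ne: "S - {a} \<noteq> {}" "S - {b} \<noteq> {}" using a b by auto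
        have "(\<Sum>x\<in>S - {a}. x ^ 0 / (\<Prod>y\<in>S - {a} - {x}. x - y)) = (if 0 = card (S - {a}) - 1 then 1 else 0)"
          by (rule less.hyps) (use less.prems card ne in auto)
        moreover have "(\<Sum>x\<in>S - {b}. x ^ 0 / (\<Prod>y\<in>S - {b} - {x}. x - y)) = (if 0 = card (S - {b}) - 1 then 1 else 0)"
          by (rule less.hyps) (use less.prems card ne in auto)
        ultimately show ?thesis unfolding drop[OF a] drop[OF b(1)] card by simp
      qed
      finally show ?thesis using b card 0 by auto
    next
      case (Suc l)
      have ne: "S - {a} \<noteq> {}" using b by auto
      have "(\<Sum>x\<in>S. x ^ k / (\<Prod>y\<in>S - {x}. x - y))
          = (\<Sum>x\<in>S. (x - a) * x ^ l / (\<Prod>y\<in>S - {x}. x - y))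
            + a * (\<Sum>x\<in>S. x ^ l / (\<Prod>y\<in>S - {x}. x - y))"
        unfolding sum_distrib_left sum.distrib[symmetric]
        by (rule sum.cong) (simp_all add: Suc algebra_simps add_divide_distrib[symmetric])
      also have "(\<Sum>x\<in>S. x ^ l / (\<Prod>y\<in>S - {x}. x - y)) = 0"
        using less.hyps[of S l] less.prems Suc by auto
      also have "(\<Sum>x\<in>S. (x - a) * x ^ l / (\<Prod>y\<in>S - {x}. x - y)) = (if l = card (S - {a}) - 1 then 1 else 0)"
        unfolding drop[OF a] by (rule less.hyps) (use less.prems card ne Suc in auto)
      finally show ?thesis using Suc card by auto
    qed
  qed
qed

lemma prod_one_minus_ge:
  fixes f :: "'b \<Rightarrow> real"
  assumes "finite A" "\<And>i. i \<in> A \<Longrightarrow> 0 \<le> f i \<and> f i \<le> 1"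
  shows "1 - (\<Sum>i\<in>A. f i) \<le> (\<Prod>i\<in>A. 1 - f i)"
  using assms
proof (induction A rule: finite_induct)
  case (insert x A)
  have P: "0 \<le> (\<Prod>i\<in>A. 1 - f i)" "(\<Prod>i\<in>A. 1 - f i) \<le> 1"
    using insert.prems by (auto intro!: prod_nonneg prod_le_1)
  have "1 - f x - (\<Sum>i\<in>A. f i) \<le> (\<Prod>i\<in>A. 1 - f i) - f x" using insert by auto
  also have "\<dots> \<le> (\<Prod>i\<in>A. 1 - f i) - f x * (\<Prod>i\<in>A. 1 - f i)"
    using insert.prems P by (simp add: mult_left_le)
  finally show ?case using insert by (simp add: algebra_simps)
qed simp

lemma sum_inverse_squares_le: "(\<Sum>j=1..r. 1 / (real j)\<^sup>2) \<le> 2"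
proof -
  have "(\<Sum>j=1..r. 1 / (real j)\<^sup>2) \<le> 2 - 1 / real r" if "r \<ge> 1"
    using that
  proof (induction r rule: dec_induct)
    case (step r)
    have "1 / (real (Suc r))\<^sup>2 \<le> 1 / (real r * real (Suc r))"
      unfolding power2_eq_square using step by (intro divide_left_mono mult_right_mono) auto
    also have "\<dots> = 1 / real r - 1 / real (Suc r)"
      using step by (simp add: field_simps)
    finally have "1 / (real (Suc r))\<^sup>2 \<le> 1 / real r - 1 / real (Suc r)" .
    then show ?case using step by simp
  qed simp
  then show ?thesis by (cases "r \<ge> 1") (force intro: order_trans)+
qed

text \<open>Factoring each difference of squares gives the closed form
  \<open>2 * (fact r)^2 / (fact (r - j) * fact (r + j))\<close>. The quotient after the 2 is at most
  1, since the \<open>j\<close> factors of \<open>fact r / fact (r - j)\<close> are dominated by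
  those of \<open>fact (r + j) / fact r\<close>.\<close>

lemma prod_square_ratio_le:
  assumes "1 \<le> j" "j \<le> r"
  shows "(\<Prod>i\<in>{1..r} - {j}. (real i)\<^sup>2 / \<bar>(real i)\<^sup>2 - (real j)\<^sup>2\<bar>) \<le> 2"
proof -
  define num den where "num = (\<Prod>i\<in>{1..r}. (real i)\<^sup>2)"
    and "den = (\<Prod>i\<in>{1..r} - {j}. \<bar>(real i)\<^sup>2 - (real j)\<^sup>2\<bar>)"
  have num: "num = (fact r)\<^sup>2" unfolding num_def by (simp add: fact_prod prod_power_distrib)
  have split: "{1..r} - {j} = {1..<j} \<union> {j<..r}" using assms by auto
  have minus: "(\<Prod>i\<in>{1..r} - {j}. \<bar>real i - real j\<bar>) = fact (j - 1) * fact (r - j)"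
  proof -
    have "(\<Prod>i\<in>{1..<j}. \<bar>real i - real j\<bar>) = (\<Prod>i\<in>{1..j-1}. real i)"
      by (rule prod.reindex_bij_witness[of _ "\<lambda>i. j - i" "\<lambda>i. j - i"]) (auto simp: of_nat_diff)
    moreover have "(\<Prod>i\<in>{j<..r}. \<bar>real i - real j\<bar>) = (\<Prod>i\<in>{1..r-j}. real i)"
      by (rule prod.reindex_bij_witness[of _ "\<lambda>i. j + i" "\<lambda>i. i - j"]) (auto simp: of_nat_diff)
    ultimately show ?thesis unfolding split
      by (subst prod.union_disjoint) (auto simp: fact_prod)
  qed
  have plus: "fact j * (2 * real j) * (\<Prod>i\<in>{1..r} - {j}. real i + real j) = fact (r + j)"
  proof -
    have "2 * real j * (\<Prod>i\<in>{1..r} - {j}. real i + real j) = (\<Prod>i\<in>{1..r}. real i + real j)"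
      using assms by (subst (2) prod.remove[of _ j]) auto
    also have "\<dots> = (\<Prod>i\<in>{j+1..r+j}. real i)"
      by (rule prod.reindex_bij_witness[of _ "\<lambda>i. i - j" "\<lambda>i. i + j"]) (auto simp: of_nat_diff)
    finally have "fact j * (2 * real j) * (\<Prod>i\<in>{1..r} - {j}. real i + real j)
        = (\<Prod>i\<in>{1..j}. real i) * (\<Prod>i\<in>{j+1..r+j}. real i)"
      by (simp add: fact_prod mult_ac)
    also have "\<dots> = (\<Prod>i\<in>{1..j} \<union> {j+1..r+j}. real i)"
      by (rule prod.union_disjoint[symmetric]) auto
    also have "{1..j} \<union> {j+1..r+j} = {1..r+j}" using assms by auto
    finally show ?thesis by (simp add: fact_prod)
  qed
  have den: "den = fact (j - 1) * fact (r - j) * (\<Prod>i\<in>{1..r} - {j}. real i + real j)"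
    unfolding den_def minus[symmetric] prod.distrib[symmetric]
    by (rule prod.cong) (auto simp: power2_eq_square square_diff_square_factored abs_mult)
  have fj: "fact j = real j * fact (j - 1)" using assms by (simp add: fact_reduce)
  have den': "2 * (real j)\<^sup>2 * den = fact (r - j) * fact (r + j)"
    unfolding plus[symmetric] den fj by (simp add: power2_eq_square)
  have fact_le: "(fact r)\<^sup>2 \<le> (fact (r - j) * fact (r + j) :: real)"
  proof -
    have "(fact r :: real) = fact (r - j) * (\<Prod>i\<in>{r-j+1..r}. real i)"
    proof -
      have "{1..r} = {1..r-j} \<union> {r-j+1..r}" by auto
      then show ?thesis unfolding fact_prod of_nat_prod by (subst prod.union_disjoint[symmetric]) auto
    qed
    also have "(\<Prod>i\<in>{r-j+1..r}. real i) \<le> (\<Prod>i\<in>{r-j+1..r}. real (i + j))"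
      by (rule prod_mono) auto
    also have "(\<Prod>i\<in>{r-j+1..r}. real (i + j)) = (\<Prod>i\<in>{r+1..r+j}. real i)"
      using assms by (intro prod.reindex_bij_witness[of _ "\<lambda>i. i - j" "\<lambda>i. i + j"]) auto
    finally have "fact r * fact r \<le> fact r * (fact (r - j) * (\<Prod>i\<in>{r+1..r+j}. real i))"
      by (simp add: mult_left_mono)
    moreover have "(fact (r + j) :: real) = fact r * (\<Prod>i\<in>{r+1..r+j}. real i)"
    proof -
      have "{1..r+j} = {1..r} \<union> {r+1..r+j}" by auto
      then show ?thesis unfolding fact_prod of_nat_prod by (subst prod.union_disjoint[symmetric]) auto
    qed
    ultimately show ?thesis by (simp add: power2_eq_square mult_ac)
  qed
  have "(\<Prod>i\<in>{1..r} - {j}. (real i)\<^sup>2 / \<bar>(real i)\<^sup>2 - (real j)\<^sup>2\<bar>) = (\<Prod>i\<in>{1..r} - {j}. (real i)\<^sup>2) / den"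
    by (simp add: den_def prod_dividef)
  also have "\<dots> = num / ((real j)\<^sup>2 * den)"
  proof -
    have "num = (real j)\<^sup>2 * (\<Prod>i\<in>{1..r} - {j}. (real i)\<^sup>2)"
      unfolding num_def using assms by (intro prod.remove) auto
    then show ?thesis using assms by simp
  qed
  also have "\<dots> = 2 * (num / (2 * (real j)\<^sup>2 * den))" by simp
  also have "\<dots> \<le> 2 * 1"
    unfolding den' num using fact_le by (intro mult_left_mono) auto
  finally show ?thesis by simp
qed

lemma pmf_of_weights:
  fixes w :: "'i \<Rightarrow> real"
  assumes I: "finite I" and w: "\<And>i. i \<in> I \<Longrightarrow> w i \<ge> 0" and pos: "(\<Sum>i\<in>I. w i) > 0"
  shows "\<exists>p. \<forall>i. pmf p i = (if i \<in> I then w i / (\<Sum>j\<in>I. w j) else 0)"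
proof -
  define h where "h i = (if i \<in> I then w i / (\<Sum>j\<in>I. w j) else 0)" for i
  have h0: "\<And>i. h i \<ge> 0" using w pos by (simp add: h_def)
  have "(\<integral>\<^sup>+i. ennreal (h i) \<partial>count_space UNIV) = (\<Sum>i\<in>I. ennreal (h i))"
    by (rule nn_integral_count_space'[OF I]) (auto simp: h_def)
  also have "\<dots> = ennreal (\<Sum>i\<in>I. h i)" using h0 by simp
  also have "(\<Sum>i\<in>I. h i) = 1" using pos by (simp add: h_def sum_divide_distrib[symmetric])
  finally have "pmf (embed_pmf h) i = h i" for i by (intro pmf_embed_pmf h0) simp
  then show ?thesis unfolding h_def by blast
qed

text \<open>As the total is 0, the positive and the negative part have the same mass, so one
  normaliser serves both. The difference of the two distributions is then \<open>R / Z\<close>, and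
  linear relations satisfied by \<open>R\<close> pass to it.\<close>

lemma jordan_decomposition_pmf:
  fixes R :: "'i \<Rightarrow> real"
  assumes S: "finite S" and sum0: "(\<Sum>x\<in>S. R x) = 0" and ne: "\<exists>x\<in>S. R x \<noteq> 0"
  defines "Z \<equiv> (\<Sum>x\<in>S. max 0 (R x))"
  shows "Z > 0 \<and> (\<exists>p. \<forall>x. pmf p x = (if x \<in> S then max 0 (R x) / Z else 0))
    \<and> (\<exists>q. \<forall>x. pmf q x = (if x \<in> S then max 0 (- R x) / Z else 0))"
proof -
  have Z': "Z = (\<Sum>x\<in>S. max 0 (- R x))"
  proof -
    have "(\<Sum>x\<in>S. max 0 (R x)) - (\<Sum>x\<in>S. max 0 (- R x)) = (\<Sum>x\<in>S. R x)"
      unfolding sum_subtractf[symmetric] by (rule sum.cong) auto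
    then show ?thesis using sum0 by (simp add: Z_def)
  qed
  have Z: "Z > 0"
  proof -
    obtain x where x: "x \<in> S" "R x \<noteq> 0" using ne by auto
    show ?thesis
    proof (cases "R x > 0")
      case True
      then show ?thesis unfolding Z_def using S x by (intro sum_pos2[of _ x]) auto
    next
      case False
      then show ?thesis unfolding Z' using S x by (intro sum_pos2[of _ x]) auto
    qed
  qed
  show ?thesis
    using pmf_of_weights[OF S, of "\<lambda>x. max 0 (R x)"] pmf_of_weights[OF S, of "\<lambda>x. max 0 (- R x)"]
      Z unfolding Z_def[symmetric] Z'[symmetric] by simp
qed

text \<open>
  The divided difference on the nodes, normalised to weight 1 at 0, annihilates polynomials. Since
  the nodes grow quadratically and the two nodes 1 and \<open>a\<close> are close to 0, the weight at a far
  node \<open>x\<close> is of order $1/x^2$: the weight at 0 is almost the whole positive part, and the negative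
  part, which sits mainly at 1, has bounded mean.
\<close>

locale dual_nodes =
  fixes a r :: nat
  assumes a: "a \<ge> 2"
begin

text \<open>The scale \<open>4 * a\<close> makes 1 and \<open>a\<close> at most a quarter of every
  far node. It cancels from the ratios between far nodes, which leaves the ratios of squares in
  \<open>prod_square_ratio_le\<close>.\<close>

definition far_node :: "nat \<Rightarrow> nat" where "far_node j = 4 * a * j\<^sup>2"
definition nodes :: "nat set" where "nodes = {0, 1, a} \<union> far_node ` {1..r}"
definition dual :: "nat \<Rightarrow> real" where
  "dual x = (if x = 0 then 1 else - (\<Prod>y\<in>nodes - {0, x}. real y / (real y - real x)))"

lemma far_node_gt: "j \<ge> 1 \<Longrightarrow> far_node j \<ge> 4 * a"
  by (simp add: far_node_def)

lemma far_node_notin: "j \<ge> 1 \<Longrightarrow> far_node j \<notin> {0, 1, a}"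
  using far_node_gt[of j] a by auto

lemma nodes_disjoint: "{0, 1, a} \<inter> far_node ` {1..r} = {}"
proof -
  have "x \<notin> {0, 1, a}" if "x \<in> far_node ` {1..r}" for x
    using that far_node_notin by fastforce
  then show ?thesis by blast
qed

lemma inj_far_node: "inj_on far_node A"
  using a by (auto simp: inj_on_def far_node_def)

lemma finite_nodes: "finite nodes" by (simp add: nodes_def)

lemma card_nodes: "card nodes = r + 3"
proof -
  have "card nodes = card {0, 1, a} + card (far_node ` {1..r})"
    unfolding nodes_def by (rule card_Un_disjoint[OF _ _ nodes_disjoint]) auto
  then show ?thesis using a card_image[OF inj_far_node, of "{1..r}"] by simp
qed

lemma zero_in_nodes: "0 \<in> nodes" by (simp add: nodes_def)

text \<open>Up to the common factor \<open>C\<close>, \<open>dual\<close> consists of the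
  coefficients of the divided difference on \<open>r + 3\<close> nodes, which vanishes on powers
  below \<open>r + 2\<close>.\<close>

lemma dual_moments:
  assumes "k \<le> r"
  shows "(\<Sum>x\<in>nodes. dual x * real x ^ k) = 0"
proof -
  define C where "C = (\<Prod>y\<in>nodes - {0}. - real y)"
  have C: "C \<noteq> 0" unfolding C_def using finite_nodes by (subst prod_zero_iff) auto
  have dual: "dual x = C / (\<Prod>y\<in>nodes - {x}. real x - real y)" if x: "x \<in> nodes" for x
  proof (cases "x = 0")
    case True
    then show ?thesis using C by (simp add: C_def dual_def)
  next
    case False
    have eq: "nodes - {0} - {x} = nodes - {0, x}" "nodes - {x} - {0} = nodes - {0, x}" by auto
    have "C = - real x * (\<Prod>y\<in>nodes - {0, x}. - real y)"
      unfolding C_def eq(1)[symmetric] using x False finite_nodes by (intro prod.remove) auto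
    moreover have "(\<Prod>y\<in>nodes - {x}. real x - real y) = (real x - real 0) * (\<Prod>y\<in>nodes - {0, x}. real x - real y)"
      unfolding eq(2)[symmetric] using False finite_nodes zero_in_nodes by (intro prod.remove) auto
    ultimately have "C / (\<Prod>y\<in>nodes - {x}. real x - real y)
        = - ((\<Prod>y\<in>nodes - {0, x}. - real y) / (\<Prod>y\<in>nodes - {0, x}. real x - real y))"
      using False by simp
    also have "\<dots> = - (\<Prod>y\<in>nodes - {0, x}. (- real y) / (real x - real y))"
      by (simp only: prod_dividef)
    also have "(\<Prod>y\<in>nodes - {0, x}. (- real y) / (real x - real y)) = (\<Prod>y\<in>nodes - {0, x}. real y / (real y - real x))"
    proof (rule prod.cong[OF refl])
      fix y
      have "- real y / (real x - real y) = (- real y) / (- (real y - real x))" by simp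
      also have "\<dots> = real y / (real y - real x)" by (rule minus_divide_divide)
      finally show "- real y / (real x - real y) = real y / (real y - real x)" .
    qed
    finally show ?thesis using False by (simp add: dual_def)
  qed
  have im: "real ` nodes - {real x} = real ` (nodes - {x})" for x by auto
  have prodim: "(\<Prod>y\<in>real ` nodes - {real x}. real x - y) = (\<Prod>y\<in>nodes - {x}. real x - real y)" for x
    unfolding im by (subst prod.reindex) auto
  have "(\<Sum>x\<in>nodes. dual x * real x ^ k) = C * (\<Sum>x\<in>nodes. real x ^ k / (\<Prod>y\<in>nodes - {x}. real x - real y))"
    unfolding sum_distrib_left by (rule sum.cong) (simp_all add: dual)
  also have "(\<Sum>x\<in>nodes. real x ^ k / (\<Prod>y\<in>nodes - {x}. real x - real y))
      = (\<Sum>x\<in>real ` nodes. x ^ k / (\<Prod>y\<in>real ` nodes - {x}. x - y))"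
    by (subst sum.reindex) (auto simp: prodim)
  also have "\<dots> = 0"
    using assms card_nodes zero_in_nodes
    by (subst divided_difference_power) (auto simp: finite_nodes card_image)
  finally show ?thesis by simp
qed

text \<open>All nodes other than 0 and 1 exceed 1, so every factor is greater than 1. The sign
  matters: the node 1 carries a weight of absolute value at least 1, which must go to
  \<open>q\<close> and stay out of \<open>Z\<close>.\<close>

lemma dual_one_neg: "dual 1 < 0"
proof -
  have "(\<Prod>y\<in>nodes - {0, 1}. real y / (real y - real 1)) > 0"
    by (rule prod_pos) (auto simp: not_less_eq_eq)
  then show ?thesis by (simp add: dual_def)
qed

text \<open>The node 1 contributes \<open>1 / (a - 1)\<close>. The far nodes contribute a partial
  Wallis product, with factors 1/(1 - 1/(4j^2)); it is at most 2 because the 1/(4j^2) sum to at most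
  1/2.\<close>

lemma abs_dual_a: "\<bar>dual a\<bar> \<le> 2 / (real a - 1)"
proof -
  have set: "nodes - {0, a} = insert 1 (far_node ` {1..r})"
  proof -
    have "({0, 1, a} \<union> F) - {0, a} = insert 1 F" if "{0, 1, a} \<inter> F = {}" for F
      using that a by auto
    then show ?thesis using nodes_disjoint unfolding nodes_def by blast
  qed
  have "\<bar>dual a\<bar> = (\<Prod>y\<in>nodes - {0, a}. \<bar>real y / (real y - real a)\<bar>)"
    using a by (simp add: dual_def abs_prod)
  also have "\<dots> = 1 / (real a - 1) * (\<Prod>j\<in>{1..r}. \<bar>real (far_node j) / (real (far_node j) - real a)\<bar>)"
    unfolding set using a nodes_disjoint
    by (subst prod.insert) (auto simp: prod.reindex[OF inj_far_node] comp_def)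
  also have "(\<Prod>j\<in>{1..r}. \<bar>real (far_node j) / (real (far_node j) - real a)\<bar>) \<le> 2"
  proof -
    have "1 / 2 \<le> 1 - (\<Sum>j\<in>{1..r}. 1 / 4 * (1 / (real j)\<^sup>2))"
      unfolding sum_distrib_left[symmetric] using sum_inverse_squares_le[of r] by simp
    also have "\<dots> \<le> (\<Prod>j\<in>{1..r}. 1 - 1 / 4 * (1 / (real j)\<^sup>2))"
    proof (rule prod_one_minus_ge)
      fix j assume "j \<in> {1..r}"
      then have "1 / (real j)\<^sup>2 \<le> 1" by simp
      then show "0 \<le> 1 / 4 * (1 / (real j)\<^sup>2) \<and> 1 / 4 * (1 / (real j)\<^sup>2) \<le> 1" by simp
    qed simp
    finally have *: "1 / 2 \<le> (\<Prod>j\<in>{1..r}. 1 - 1 / 4 * (1 / (real j)\<^sup>2))" .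
    have "\<bar>real (far_node j) / (real (far_node j) - real a)\<bar> = inverse (1 - 1 / 4 * (1 / (real j)\<^sup>2))"
      if "j \<in> {1..r}" for j
    proof -
      have j: "real j ^ 2 \<ge> 1" using that by simp
      have "real (far_node j) - real a = real a * (4 * (real j)\<^sup>2 - 1)"
        by (simp add: far_node_def algebra_simps)
      moreover have "real a * (4 * (real j)\<^sup>2 - 1) > 0" using a j by simp
      ultimately have "\<bar>real (far_node j) / (real (far_node j) - real a)\<bar>
          = real (far_node j) / (real a * (4 * (real j)\<^sup>2 - 1))"
        by (simp only: abs_divide abs_of_nat abs_of_pos)
      also have "\<dots> = (real a * (4 * (real j)\<^sup>2)) / (real a * (4 * (real j)\<^sup>2 - 1))"
        by (simp add: far_node_def)
      also have "\<dots> = (4 * (real j)\<^sup>2) / (4 * (real j)\<^sup>2 - 1)"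
        using a by (intro mult_divide_mult_cancel_left) simp
      also have "\<dots> = inverse (1 - 1 / 4 * (1 / (real j)\<^sup>2))"
        using j that by (simp add: field_simps)
      finally show ?thesis .
    qed
    then have "(\<Prod>j\<in>{1..r}. \<bar>real (far_node j) / (real (far_node j) - real a)\<bar>)
        = inverse (\<Prod>j\<in>{1..r}. 1 - 1 / 4 * (1 / (real j)\<^sup>2))"
      by (simp add: prod_inversef[symmetric] comp_def)
    also have "\<dots> \<le> inverse (1 / 2)" using * by (intro le_imp_inverse_le) auto
    finally show ?thesis by simp
  qed
  finally show ?thesis using a by (simp add: mult_left_mono divide_right_mono)
qed

text \<open>At a far node x the near nodes 1 and \<open>a\<close> contribute about a/x^2, and the
  other far nodes at most 2. This is the purpose of the node \<open>a\<close>: with 1 alone the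
  decay would be 1/x, and the bound on each term of the mean would be a constant instead of the
  summable 1/j^2.\<close>

lemma abs_dual_far:
  assumes j: "1 \<le> j" "j \<le> r"
  shows "\<bar>dual (far_node j)\<bar> \<le> 1 / (4 * real a * real j ^ 4)"
proof -
  let ?x = "far_node j"
  have j1: "real j ^ 2 \<ge> 1" using j by simp
  have x: "real ?x = 4 * real a * (real j)\<^sup>2" by (simp add: far_node_def)
  have "4 * real a \<le> 4 * real a * (real j)\<^sup>2"
    using mult_left_mono[OF j1, of "4 * real a"] by simp
  then have xa: "real ?x \<ge> 4 * real a" unfolding x .
  have set: "nodes - {0, ?x} = {1, a} \<union> far_node ` ({1..r} - {j})"
  proof -
    have "far_node ` {1..r} - {?x} = far_node ` ({1..r} - {j})"
      by (simp add: image_set_diff[OF inj_far_node])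
    moreover have "?x \<in> far_node ` {1..r}" using j by auto
    moreover have "({0, 1, a} \<union> F) - {0, x} = {1, a} \<union> (F - {x})"
      if "{0, 1, a} \<inter> F = {}" "x \<in> F" for F x
      using that a by auto
    ultimately show ?thesis using nodes_disjoint unfolding nodes_def by metis
  qed
  have "\<bar>dual ?x\<bar> = (\<Prod>y\<in>nodes - {0, ?x}. \<bar>real y / (real y - real ?x)\<bar>)"
    using far_node_notin[OF j(1)] by (simp add: dual_def abs_prod)
  also have "\<dots> = (\<Prod>y\<in>{1, a}. \<bar>real y / (real y - real ?x)\<bar>)
      * (\<Prod>y\<in>far_node ` ({1..r} - {j}). \<bar>real y / (real y - real ?x)\<bar>)"
    unfolding set using nodes_disjoint by (intro prod.union_disjoint) blast+
  also have "(\<Prod>y\<in>far_node ` ({1..r} - {j}). \<bar>real y / (real y - real ?x)\<bar>)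
      = (\<Prod>i\<in>{1..r} - {j}. (real i)\<^sup>2 / \<bar>(real i)\<^sup>2 - (real j)\<^sup>2\<bar>)"
  proof -
    have "\<bar>real (far_node i) / (real (far_node i) - real ?x)\<bar> = (real i)\<^sup>2 / \<bar>(real i)\<^sup>2 - (real j)\<^sup>2\<bar>" for i
    proof -
      have "real (far_node i) - real ?x = 4 * real a * ((real i)\<^sup>2 - (real j)\<^sup>2)"
        by (simp add: far_node_def algebra_simps)
      then show ?thesis using a by (simp add: abs_mult far_node_def)
    qed
    then show ?thesis by (simp add: prod.reindex[OF inj_far_node] comp_def)
  qed
  also have "(\<Prod>y\<in>{1, a}. \<bar>real y / (real y - real ?x)\<bar>) = 1 / (real ?x - 1) * (real a / (real ?x - real a))"
    using a xa by simp
  \<comment> \<open>Both \<open>x - 1\<close> and \<open>x - a\<close> are at least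
    \<open>3/4 * x\<close>, because \<open>x\<close> is at least \<open>4 * a\<close>.\<close>
  also have "\<dots> * (\<Prod>i\<in>{1..r} - {j}. (real i)\<^sup>2 / \<bar>(real i)\<^sup>2 - (real j)\<^sup>2\<bar>)
      \<le> (1 / (3 / 4 * real ?x) * (real a / (3 / 4 * real ?x))) * 2"
    using a xa prod_square_ratio_le[OF j]
    by (intro mult_mono divide_left_mono mult_nonneg_nonneg prod_nonneg) auto
  also have "\<dots> = 2 / (9 * real a * real j ^ 4)"
    unfolding x using a j by (simp add: field_simps eval_nat_numeral)
  also have "\<dots> \<le> 1 / (4 * real a * real j ^ 4)"
    using a j by (simp add: field_simps)
  finally show ?thesis .
qed

lemma sum_nodes:
  fixes f :: "nat \<Rightarrow> real"
  shows "(\<Sum>x\<in>nodes. f x) = f 0 + f 1 + f a + (\<Sum>j=1..r. f (far_node j))"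
proof -
  have "(\<Sum>x\<in>nodes. f x) = (\<Sum>x\<in>{0, 1, a}. f x) + (\<Sum>x\<in>far_node ` {1..r}. f x)"
    unfolding nodes_def by (rule sum.union_disjoint[OF _ _ nodes_disjoint]) auto
  then show ?thesis using a by (simp add: sum.reindex[OF inj_far_node])
qed

text \<open>The mass of \<open>p\<close> at 0 is \<open>1 / Z\<close>, and \<open>Z - 1\<close> is
  at most \<open>2 / (a - 1)\<close> from the node \<open>a\<close> plus \<open>1 / (a - 1)\<close>
  from the far nodes. The mean bound 7 is 1 + 4 + 2, from the node 1, the node \<open>a\<close> and
  the far nodes.\<close>

lemma matching_priors:
  "\<exists>p q :: nat pmf. set_pmf p \<subseteq> nodes \<and> set_pmf q \<subseteq> nodes
    \<and> (\<forall>k\<le>r. (\<Sum>x\<in>nodes. (pmf p x - pmf q x) * real x ^ k) = 0)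
    \<and> pmf p 0 \<ge> 1 - 3 / (real a - 1) \<and> 0 \<notin> set_pmf q \<and> (\<Sum>x\<in>nodes. real x * pmf q x) \<le> 7"
proof -
  define Z where "Z = (\<Sum>x\<in>nodes. max 0 (dual x))"
  have sum0: "(\<Sum>x\<in>nodes. dual x) = 0" using dual_moments[of 0] by simp
  have d0: "dual 0 = 1" by (simp add: dual_def)
  obtain p q where Z: "Z > 0"
    and p: "\<And>x. pmf p x = (if x \<in> nodes then max 0 (dual x) / Z else 0)"
    and q: "\<And>x. pmf q x = (if x \<in> nodes then max 0 (- dual x) / Z else 0)"
    using jordan_decomposition_pmf[OF finite_nodes sum0] zero_in_nodes d0
    unfolding Z_def by (metis zero_neq_one)
  have Z1: "Z \<ge> 1"
    unfolding Z_def using member_le_sum[OF zero_in_nodes, of "\<lambda>x. max 0 (dual x)"] finite_nodes d0 by auto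
  have inv_a: "1 / real a \<le> 1 / (real a - 1)" using a by (simp add: field_simps)
  have Zle: "Z \<le> 1 + 3 / (real a - 1)"
  proof -
    have "Z = 1 + max 0 (dual a) + (\<Sum>j=1..r. max 0 (dual (far_node j)))"
      unfolding Z_def sum_nodes using dual_one_neg by (simp add: d0)
    also have "(\<Sum>j=1..r. max 0 (dual (far_node j))) \<le> (\<Sum>j=1..r. 1 / (4 * real a) * (1 / (real j)\<^sup>2))"
    proof (rule sum_mono)
      fix j assume "j \<in> {1..r}"
      then have j: "1 \<le> j" "j \<le> r" by auto
      have "max 0 (dual (far_node j)) \<le> 1 / (4 * real a * real j ^ 4)"
        using abs_dual_far[OF j] a by auto
      also have "\<dots> \<le> 1 / (4 * real a * real j ^ 2)"
        using a j by (intro divide_left_mono mult_left_mono power_increasing) auto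
      finally show "max 0 (dual (far_node j)) \<le> 1 / (4 * real a) * (1 / (real j)\<^sup>2)" by simp
    qed
    also have "\<dots> \<le> 1 / (4 * real a) * 2"
      unfolding sum_distrib_left[symmetric] by (rule mult_left_mono[OF sum_inverse_squares_le]) simp
    also have "\<dots> \<le> 1 / (real a - 1)" using a by (simp add: field_simps)
    also have "max 0 (dual a) \<le> 2 / (real a - 1)" using abs_dual_a a by auto
    finally show ?thesis by (simp add: add_divide_distrib[symmetric])
  qed
  have pq: "pmf p x - pmf q x = dual x / Z" if "x \<in> nodes" for x
    using that by (auto simp: p q max_def diff_divide_distrib)
  show ?thesis
  proof (rule exI[of _ p], rule exI[of _ q], intro conjI allI impI)
    show "set_pmf p \<subseteq> nodes" by (auto simp: set_pmf_iff p split: if_splits)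
    show "set_pmf q \<subseteq> nodes" by (auto simp: set_pmf_iff q split: if_splits)
    show "(\<Sum>x\<in>nodes. (pmf p x - pmf q x) * real x ^ k) = 0" if "k \<le> r" for k
    proof -
      have "(\<Sum>x\<in>nodes. (pmf p x - pmf q x) * real x ^ k) = (\<Sum>x\<in>nodes. dual x * real x ^ k) / Z"
        unfolding sum_divide_distrib by (rule sum.cong) (auto simp: pq)
      then show ?thesis using dual_moments[OF that] by simp
    qed
    show "pmf p 0 \<ge> 1 - 3 / (real a - 1)"
    proof -
      define t where "t = 3 / (real a - 1)"
      have t: "Z \<le> 1 + t" "t \<ge> 0" using Zle a by (auto simp: t_def)
      have "(1 - t) * Z \<le> 1"
      proof (cases "t \<le> 1")
        case True
        then have "(1 - t) * Z \<le> (1 - t) * (1 + t)" using t by (intro mult_left_mono) auto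
        also have "\<dots> \<le> 1" by (simp add: algebra_simps)
        finally show ?thesis .
      next
        case False
        then have "(1 - t) * Z \<le> 0" using Z by (intro mult_nonpos_nonneg) auto
        then show ?thesis by simp
      qed
      then have "1 - t \<le> 1 / Z" unfolding pos_le_divide_eq[OF Z] .
      moreover have "pmf p 0 = 1 / Z" using zero_in_nodes by (simp add: p d0)
      ultimately show ?thesis unfolding t_def by metis
    qed
    show "0 \<notin> set_pmf q" by (simp add: set_pmf_iff q d0)
    show "(\<Sum>x\<in>nodes. real x * pmf q x) \<le> 7"
    proof -
      have qle: "pmf q x \<le> \<bar>dual x\<bar>" for x
      proof -
        have "max 0 (- dual x) / Z \<le> \<bar>dual x\<bar> / 1" using Z1 by (intro frac_le) auto
        then show ?thesis by (simp add: q)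
      qed
      have "real a * pmf q a \<le> real a * (2 / (real a - 1))"
        using order_trans[OF qle abs_dual_a] by (intro mult_left_mono) auto
      also have "\<dots> \<le> 4" using a by (simp add: field_simps)
      finally have "real a * pmf q a \<le> 4" .
      moreover have "pmf q 1 \<le> 1" by (rule pmf_le_1)
      moreover have "(\<Sum>j=1..r. real (far_node j) * pmf q (far_node j)) \<le> (\<Sum>j=1..r. 1 / (real j)\<^sup>2)"
      proof (rule sum_mono)
        fix j assume "j \<in> {1..r}"
        then have j: "1 \<le> j" "j \<le> r" by auto
        have "real (far_node j) * pmf q (far_node j) \<le> real (far_node j) * (1 / (4 * real a * real j ^ 4))"
          using order_trans[OF qle abs_dual_far[OF j]] by (intro mult_left_mono) auto
        also have "\<dots> = 1 / (real j)\<^sup>2" using a j by (simp add: far_node_def field_simps eval_nat_numeral)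
        finally show "real (far_node j) * pmf q (far_node j) \<le> 1 / (real j)\<^sup>2" .
      qed
      ultimately show ?thesis unfolding sum_nodes using sum_inverse_squares_le[of r] by simp
    qed
  qed
qed

end

lemma moment_matching_priors:
  assumes "r \<ge> 1"
  shows "\<exists>(p :: nat pmf) q S. S \<subseteq> {..160004 * r\<^sup>2} \<and> set_pmf p \<subseteq> S \<and> set_pmf q \<subseteq> S
    \<and> (\<forall>k\<le>r. (\<Sum>x\<in>S. (pmf p x - pmf q x) * real x ^ k) = 0)
    \<and> pmf p 0 \<ge> 1 - 1 / 8000 \<and> 0 \<notin> set_pmf q \<and> (\<Sum>x\<in>S. real x * pmf q x) \<le> 7"
proof -
  \<comment> \<open>With this \<open>a\<close>, the loss \<open>3 / (a - 1)\<close> is below 1/8000,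
    and the largest node \<open>4 * a * r^2\<close> is the stated end of the range.\<close>
  interpret dual_nodes 40001 r by standard simp
  have r2: "1 \<le> r\<^sup>2" using assms by simp
  have "nodes \<subseteq> {..160004 * r\<^sup>2}"
    using r2 by (auto simp: nodes_def far_node_def intro: power_mono)
  moreover have "1 - 3 / (real 40001 - 1) \<ge> (1 - 1 / 8000 :: real)" by simp
  ultimately show ?thesis using matching_priors by (meson order_trans)
qed

subsection \<open>Indistinguishability of the priors\<close>

text \<open>In the Taylor series of \<open>G\<close> at 0 the moment conditions kill all terms of
  order at most \<open>r\<close>. Cauchy's inequality on the circle of radius \<open>R\<close> and
  the bound \<open>R / 2\<close> on the points make the term of order n at most a multiple of 2^-n;
  the tail from \<open>r + 1\<close> sums to 2^-r.\<close>

lemma holomorphic_annihilator_bound: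
  fixes G :: "complex \<Rightarrow> complex" and c t :: "'i \<Rightarrow> real"
  assumes hol: "G holomorphic_on ball 0 \<rho>" and R: "0 < R" "R < \<rho>"
    and C: "\<And>z. norm z = R \<Longrightarrow> norm (G z) \<le> C"
    and t: "\<And>x. x \<in> S \<Longrightarrow> \<bar>t x\<bar> \<le> R / 2"
    and mom: "\<And>k. k \<le> r \<Longrightarrow> (\<Sum>x\<in>S. c x * t x ^ k) = 0"
  shows "norm (\<Sum>x\<in>S. of_real (c x) * G (of_real (t x))) \<le> (\<Sum>x\<in>S. \<bar>c x\<bar>) * C * (1/2) ^ r"
proof -
  define K where "K = (\<Sum>x\<in>S. \<bar>c x\<bar>)"
  define a where "a n = (deriv ^^ n) G 0 / fact n" for n
  have C0: "C \<ge> 0" using C[of "of_real R"] R norm_ge_zero order_trans by (metis norm_of_real abs_of_pos)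
  have a: "norm (a n) \<le> C / R ^ n" for n
  proof -
    have "norm ((deriv ^^ n) G 0) \<le> fact n * C / R ^ n"
    proof (rule Cauchy_inequality)
      have sub: "cball 0 R \<subseteq> ball (0::complex) \<rho>" using R by auto
      then show "continuous_on (cball 0 R) G"
        using hol holomorphic_on_imp_continuous_on holomorphic_on_subset by blast
      show "G holomorphic_on ball 0 R"
        using hol R by (rule_tac holomorphic_on_subset) auto
      show "norm (G z) \<le> C" if "norm (0 - z) = R" for z using C that by simp
    qed (use R in auto)
    then show ?thesis by (simp add: a_def norm_divide field_simps)
  qed
  define f where "f n = a n * of_real (\<Sum>x\<in>S. c x * t x ^ n)" for n
  have sums: "f sums (\<Sum>x\<in>S. of_real (c x) * G (of_real (t x)))"
  proof -
    have "(\<lambda>n. \<Sum>x\<in>S. of_real (c x) * (a n * of_real (t x) ^ n)) sums (\<Sum>x\<in>S. of_real (c x) * G (of_real (t x)))"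
    proof (intro sums_sum sums_mult)
      fix x assume "x \<in> S"
      then have "\<bar>t x\<bar> < \<rho>" using t[of x] R by linarith
      then have "of_real (t x) \<in> ball (0::complex) \<rho>" by simp
      from holomorphic_power_series[OF hol this]
      show "(\<lambda>n. a n * of_real (t x) ^ n) sums G (of_real (t x))" by (simp add: a_def)
    qed
    moreover have "(\<lambda>n. \<Sum>x\<in>S. of_real (c x) * (a n * of_real (t x) ^ n)) = f"
      by (auto simp: f_def sum_distrib_left mult_ac)
    ultimately show ?thesis by simp
  qed
  have f0: "f n = 0" if "n < Suc r" for n using mom[of n] that by (simp add: f_def)
  have sums': "(\<lambda>n. f (n + Suc r)) sums (\<Sum>x\<in>S. of_real (c x) * G (of_real (t x)))"
    using sums_split_initial_segment[OF sums, of "Suc r"] f0 by simp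
  have geo: "(\<lambda>n. K * C * (1/2) ^ Suc r * (1/2) ^ n) sums (K * C * (1/2) ^ Suc r * 2)"
    using geometric_sums[of "1/2 :: real"] by (intro sums_mult) simp
  have f_le: "norm (f (n + Suc r)) \<le> K * C * (1/2) ^ Suc r * (1/2) ^ n" for n
  proof -
    let ?n = "n + Suc r"
    have "norm (f ?n) = norm (a ?n) * \<bar>\<Sum>x\<in>S. c x * t x ^ ?n\<bar>"
      by (simp only: f_def norm_mult norm_of_real)
    also have "\<dots> \<le> (C / R ^ ?n) * (K * (R / 2) ^ ?n)"
    proof (rule mult_mono[OF a])
      have "\<bar>\<Sum>x\<in>S. c x * t x ^ ?n\<bar> \<le> (\<Sum>x\<in>S. \<bar>c x\<bar> * (R / 2) ^ ?n)"
        using t by (intro order_trans[OF sum_abs] sum_mono)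
          (auto simp: abs_mult power_abs simp del: power_Suc power_divide intro!: mult_left_mono power_mono)
      then show "\<bar>\<Sum>x\<in>S. c x * t x ^ ?n\<bar> \<le> K * (R / 2) ^ ?n"
        by (simp only: K_def sum_distrib_right)
      show "0 \<le> C / R ^ ?n" using C0 R by simp
    qed simp
    also have "\<dots> = K * C * (1/2) ^ ?n" using R by (simp add: power_divide)
    also have "(1/2 :: real) ^ ?n = (1/2) ^ Suc r * (1/2) ^ n" by (simp add: power_add)
    finally show ?thesis by (simp add: mult_ac)
  qed
  have "norm (\<Sum>x\<in>S. of_real (c x) * G (of_real (t x))) \<le> K * C * (1/2) ^ Suc r * 2"
    using norm_sums_le[OF sums' geo f_le] .
  then show ?thesis by (simp add: K_def)
qed

text \<open>
  For nonnegative weights \<open>w\<close> on \<open>I\<close>, \<open>sample_mean m I F w\<close> is the mean of \<open>F\<close> over \<open>m\<close>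
  independent samples from \<open>I\<close> with probabilities proportional to \<open>w\<close>; complex weights
  give its analytic continuation.
\<close>

definition sample_mean ::
    "nat \<Rightarrow> 'i set \<Rightarrow> ((nat \<Rightarrow> 'i) \<Rightarrow> real) \<Rightarrow> ('i \<Rightarrow> 'a::real_normed_field) \<Rightarrow> 'a" where
  "sample_mean m I F w =
     (\<Sum>x\<in>PiE {..<m} (\<lambda>_. I). of_real (F x) * (\<Prod>j<m. w (x j))) / (\<Sum>i\<in>I. w i) ^ m"

lemma of_real_sample_mean:
  "of_real (sample_mean m I F w) = sample_mean m I F (\<lambda>i. of_real (w i))"
  by (simp add: sample_mean_def)

lemma sum_PiE_prod_power:
  fixes w :: "'i \<Rightarrow> 'a::comm_semiring_1"
  assumes "finite I"
  shows "(\<Sum>x\<in>PiE {..<m::nat} (\<lambda>_. I). \<Prod>j<m. w (x j)) = (\<Sum>i\<in>I. w i) ^ m"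
  using prod_sum_PiE[of "{..<m}" "\<lambda>_. I" "\<lambda>_. w"] assms by simp

text \<open>As a function of the weight z at \<open>i\<close>, the mean has its only possible pole
  at -s, where s is the sum of the other weights. On the circle of radius \<open>R\<close> the
  numerator is at most \<open>(R + s) ^ m\<close>, by expanding the power of the sum of norms, and
  the denominator at least \<open>(s - R) ^ m\<close>. The quotient decreases in s, so s = 1 is the
  worst case.\<close>

lemma sample_mean_coordinate:
  fixes w :: "'i \<Rightarrow> real"
  assumes I: "finite I" "i \<in> I" and w: "\<And>i. w i \<ge> 0" and heavy: "(\<Sum>i\<in>I - {i}. w i) \<ge> 1"
    and F: "\<And>x. 0 \<le> F x \<and> F x \<le> 1"
    and R: "0 < R" "R < 1"
    and t: "\<And>x. x \<in> S \<Longrightarrow> \<bar>t x\<bar> \<le> R / 2"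
    and mom: "\<And>k. k \<le> r \<Longrightarrow> (\<Sum>x\<in>S. c x * t x ^ k) = 0"
  shows "\<bar>\<Sum>x\<in>S. c x * sample_mean m I F (w(i := t x))\<bar>
    \<le> (\<Sum>x\<in>S. \<bar>c x\<bar>) * ((1 + R) / (1 - R)) ^ m * (1/2) ^ r"
proof -
  define s where "s = (\<Sum>i\<in>I - {i}. w i)"
  have s1: "s \<ge> 1" using heavy by (simp add: s_def)
  define v where "v = (\<lambda>(z::complex) j. if j = i then z else of_real (w j))"
  define G where "G z = sample_mean m I F (v z)" for z
  have sum_v: "(\<Sum>j\<in>I. v z j) = z + of_real s" for z
  proof -
    have "(\<Sum>j\<in>I. v z j) = z + (\<Sum>j\<in>I - {i}. v z j)" 
      using I by (subst sum.remove) (auto simp: v_def)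
    also have "(\<Sum>j\<in>I - {i}. v z j) = (\<Sum>j\<in>I - {i}. of_real (w j))"
      by (rule sum.cong) (auto simp: v_def)
    finally show ?thesis by (simp add: s_def)
  qed
  have sum_norm_v: "(\<Sum>j\<in>I. norm (v z j)) = norm z + s" for z
  proof -
    have "(\<Sum>j\<in>I. norm (v z j)) = norm z + (\<Sum>j\<in>I - {i}. norm (v z j))" 
      using I by (subst sum.remove) (auto simp: v_def)
    also have "(\<Sum>j\<in>I - {i}. norm (v z j)) = s"
      unfolding s_def by (rule sum.cong) (auto simp: v_def w)
    finally show ?thesis .
  qed
  have G: "G z = (\<Sum>x\<in>PiE {..<m} (\<lambda>_. I). of_real (F x) * (\<Prod>j<m. v z (x j))) / (z + of_real s) ^ m" for z
    by (simp add: G_def sample_mean_def sum_v)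
  have v_hol: "(\<lambda>z. v z j) holomorphic_on A" for j A
    by (cases "j = i") (auto simp: v_def intro: holomorphic_intros)
  have hol: "G holomorphic_on ball 0 1"
    unfolding G
  proof (intro holomorphic_intros v_hol)
    fix z :: complex assume "z \<in> ball 0 1"
    then have "norm z < s" using heavy by (simp add: s_def)
    then have "z \<noteq> - of_real s"
      using abs_ge_self[of s] by (auto simp del: of_real_sum)
    then show "(z + of_real s) ^ m \<noteq> 0" by (simp add: add_eq_0_iff2)
  qed
  have bound: "norm (G z) \<le> ((1 + R) / (1 - R)) ^ m" if z: "norm z = R" for z
  proof -
    have "norm (\<Sum>x\<in>PiE {..<m} (\<lambda>_. I). of_real (F x) * (\<Prod>j<m. v z (x j)))
        \<le> (\<Sum>x\<in>PiE {..<m} (\<lambda>_. I). \<Prod>j<m. norm (v z (x j)))"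
    proof (rule sum_norm_le)
      fix x
      have "norm (of_real (F x) * (\<Prod>j<m. v z (x j))) = F x * (\<Prod>j<m. norm (v z (x j)))"
        using F[of x] by (simp add: norm_mult prod_norm)
      also have "\<dots> \<le> 1 * (\<Prod>j<m. norm (v z (x j)))"
        using F[of x] by (intro mult_right_mono prod_nonneg) auto
      finally show "norm (of_real (F x) * (\<Prod>j<m. v z (x j))) \<le> (\<Prod>j<m. norm (v z (x j)))" by simp
    qed
    also have "\<dots> = (R + s) ^ m"
      using sum_PiE_prod_power[OF I(1), where m = m and w = "\<lambda>j. norm (v z j)"] sum_norm_v z by simp
    finally have num: "norm (\<Sum>x\<in>PiE {..<m} (\<lambda>_. I). of_real (F x) * (\<Prod>j<m. v z (x j))) \<le> (R + s) ^ m" .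
    have "norm (of_real s :: complex) \<le> norm (z + of_real s) + norm z"
      using norm_triangle_ineq4[of "z + of_real s" z] by simp
    then have "s - R \<le> norm (z + of_real s)" unfolding norm_of_real using s1 z by linarith
    then have den: "(s - R) ^ m \<le> norm ((z + of_real s) ^ m)"
      unfolding norm_power using s1 R by (intro power_mono) auto
    have "norm (G z) \<le> (R + s) ^ m / (s - R) ^ m"
      unfolding G norm_divide using num den s1 R by (intro frac_le) auto
    also have "\<dots> = ((R + s) / (s - R)) ^ m" by (simp add: power_divide)
    also have "\<dots> \<le> ((1 + R) / (1 - R)) ^ m"
    proof (rule power_mono)
      have "R * 1 \<le> R * s" using s1 R by (intro mult_left_mono) auto
      then have "(R + s) * (1 - R) \<le> (1 + R) * (s - R)" by (simp add: algebra_simps)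
      then show "(R + s) / (s - R) \<le> (1 + R) / (1 - R)"
        using s1 R by (simp add: divide_simps mult_ac)
      show "0 \<le> (R + s) / (s - R)" using s1 R by simp
    qed
    finally show ?thesis .
  qed
  have "norm (\<Sum>x\<in>S. of_real (c x) * G (of_real (t x)))
      \<le> (\<Sum>x\<in>S. \<bar>c x\<bar>) * ((1 + R) / (1 - R)) ^ m * (1/2) ^ r"
    by (rule holomorphic_annihilator_bound[OF hol R bound t mom])
  moreover have "G (of_real (t x)) = of_real (sample_mean m I F (w(i := t x)))" for x
    unfolding G_def of_real_sample_mean by (rule arg_cong[where f = "\<lambda>w. sample_mean m I F w"]) (auto simp: v_def)
  ultimately have "norm (of_real (\<Sum>x\<in>S. c x * sample_mean m I F (w(i := t x))) :: complex)
      \<le> (\<Sum>x\<in>S. \<bar>c x\<bar>) * ((1 + R) / (1 - R)) ^ m * (1/2) ^ r"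
    by simp
  then show ?thesis unfolding norm_of_real .
qed

lemma expectation_pair_pmf_finite:
  fixes g :: "'a \<times> 'b \<Rightarrow> real"
  assumes "finite (set_pmf p)" "finite (set_pmf q)"
  shows "measure_pmf.expectation (pair_pmf p q) g
    = measure_pmf.expectation p (\<lambda>a. measure_pmf.expectation q (\<lambda>b. g (a, b)))"
    and "measure_pmf.expectation (pair_pmf p q) g
    = measure_pmf.expectation q (\<lambda>b. measure_pmf.expectation p (\<lambda>a. g (a, b)))"
proof -
  have 1: "measure_pmf.expectation (pair_pmf p q) g
      = (\<Sum>(a, b)\<in>set_pmf p \<times> set_pmf q. g (a, b) * (pmf p a * pmf q b))"
    using assms by (subst integral_measure_pmf_real[of "set_pmf p \<times> set_pmf q"]) (auto simp: pmf_pair intro!: sum.cong)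
  show "measure_pmf.expectation (pair_pmf p q) g
    = measure_pmf.expectation p (\<lambda>a. measure_pmf.expectation q (\<lambda>b. g (a, b)))"
    unfolding 1 using assms
    by (simp add: integral_measure_pmf_real[of "set_pmf p" p] integral_measure_pmf_real[of "set_pmf q" q]
        sum.cartesian_product[symmetric] sum_distrib_left sum_distrib_right mult_ac)
  show "measure_pmf.expectation (pair_pmf p q) g
    = measure_pmf.expectation q (\<lambda>b. measure_pmf.expectation p (\<lambda>a. g (a, b)))"
    unfolding 1 sum.cartesian_product[symmetric] using assms
    by (subst sum.swap) (simp add: integral_measure_pmf_real[of "set_pmf p" p] integral_measure_pmf_real[of "set_pmf q" q]
        sum_distrib_left sum_distrib_right mult_ac)
qed

lemma finite_set_Pi_pmf:
  assumes "finite J" "finite (set_pmf p)"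
  shows "finite (set_pmf (Pi_pmf J d (\<lambda>_. p)))"
  using assms by (subst set_Pi_pmf) (auto intro!: finite_PiE_dflt)

text \<open>Hybrid argument: coordinates are exchanged one at a time, each at cost
  \<open>\<delta>\<close>. The hypothesis holds for all values of the other coordinates, so it
  survives fixing one of them, which is why \<open>h\<close> varies in the induction.\<close>

lemma Pi_pmf_hybrid:
  fixes h :: "('i \<Rightarrow> 'b) \<Rightarrow> real" and \<delta> :: real
  assumes "finite J" and p: "finite (set_pmf p)" and q: "finite (set_pmf q)"
    and "\<And>i f. i \<in> J \<Longrightarrow> \<bar>measure_pmf.expectation p (\<lambda>y. h (f(i := y)))
      - measure_pmf.expectation q (\<lambda>y. h (f(i := y)))\<bar> \<le> \<delta>"
  shows "\<bar>measure_pmf.expectation (Pi_pmf J d (\<lambda>_. p)) h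
      - measure_pmf.expectation (Pi_pmf J d (\<lambda>_. q)) h\<bar> \<le> card J * \<delta>"
  using assms(1,4)
proof (induction J arbitrary: h rule: finite_induct)
  case empty
  then show ?case by simp
next
  case (insert i J)
  let ?P = "Pi_pmf J d (\<lambda>_. p)" and ?Q = "Pi_pmf J d (\<lambda>_. q)"
  have fin: "finite (set_pmf ?P)" "finite (set_pmf ?Q)"
    by (intro finite_set_Pi_pmf insert.hyps p q)+
  let ?E = "measure_pmf.expectation"
  have P: "?E (Pi_pmf (insert i J) d (\<lambda>_. p)) h = ?E p (\<lambda>y. ?E ?P (\<lambda>f. h (f(i := y))))"
    using insert.hyps by (simp add: Pi_pmf_insert case_prod_unfold expectation_pair_pmf_finite(1)[OF p fin(1)])
  have Q: "?E (Pi_pmf (insert i J) d (\<lambda>_. q)) h = ?E ?Q (\<lambda>f. ?E q (\<lambda>y. h (f(i := y))))"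
    using insert.hyps by (simp add: Pi_pmf_insert case_prod_unfold expectation_pair_pmf_finite(2)[OF q fin(2)])
  \<comment> \<open>The intermediate hybrid takes coordinate \<open>i\<close> from \<open>p\<close>
    and the rest from \<open>q\<close>. Exchanging the averages lets each of the two comparisons be
    made pointwise inside a common outer average.\<close>
  have PQ: "?E p (\<lambda>y. ?E ?Q (\<lambda>f. h (f(i := y)))) = ?E ?Q (\<lambda>f. ?E p (\<lambda>y. h (f(i := y))))"
    using expectation_pair_pmf_finite[OF p fin(2), of "\<lambda>(y, f). h (f(i := y))"] by simp
  have avg: "\<bar>?E M u - ?E M v\<bar> \<le> B" if "finite (set_pmf M)" "\<And>x. \<bar>u x - v x\<bar> \<le> B"
    for M :: "'z pmf" and u v :: "'z \<Rightarrow> real" and B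
  proof -
    have i: "integrable M u" "integrable M v" using that(1) by (auto intro: integrable_measure_pmf_finite)
    then have "\<bar>?E M u - ?E M v\<bar> = \<bar>?E M (\<lambda>x. u x - v x)\<bar>" by simp
    also have "\<dots> \<le> ?E M (\<lambda>x. \<bar>u x - v x\<bar>)" by (rule integral_abs_bound)
    also have "\<dots> \<le> ?E M (\<lambda>x. B)"
      using that by (intro integral_mono) (auto intro: integrable_measure_pmf_finite)
    finally show ?thesis by simp
  qed
  have 1: "\<bar>?E p (\<lambda>y. ?E ?P (\<lambda>f. h (f(i := y)))) - ?E p (\<lambda>y. ?E ?Q (\<lambda>f. h (f(i := y))))\<bar> \<le> card J * \<delta>"
  proof (rule avg[OF p])
    fix y
    show "\<bar>?E ?P (\<lambda>f. h (f(i := y))) - ?E ?Q (\<lambda>f. h (f(i := y)))\<bar> \<le> card J * \<delta>"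
    proof (rule insert.IH)
      fix i' f assume "i' \<in> J"
      moreover from this have "(f(i' := z))(i := y) = (f(i := y))(i' := z)" for z
        using insert.hyps by (auto simp: fun_upd_twist)
      ultimately show "\<bar>?E p (\<lambda>z. h ((f(i' := z))(i := y))) - ?E q (\<lambda>z. h ((f(i' := z))(i := y)))\<bar> \<le> \<delta>"
        using insert.prems[of i' "f(i := y)"] by (simp del: fun_upd_apply)
    qed
  qed
  have 2: "\<bar>?E ?Q (\<lambda>f. ?E p (\<lambda>y. h (f(i := y)))) - ?E ?Q (\<lambda>f. ?E q (\<lambda>y. h (f(i := y))))\<bar> \<le> \<delta>"
    by (rule avg[OF fin(2)]) (simp add: insert.prems)
  show ?case using 1 2 insert.hyps unfolding P Q PQ by (simp add: algebra_simps)
qed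

text \<open>The index \<open>M\<close> is an atom of weight 1, which keeps the total weight away from 0.\<close>

definition weights :: "nat \<Rightarrow> (nat \<Rightarrow> nat) \<Rightarrow> nat \<Rightarrow> real" where
  "weights M f i = (if i < M then real (f i) / real M else 1)"

lemma sample_mean_indistinguishable:
  fixes p q :: "nat pmf"
  assumes M: "M \<ge> 1" and b: "b \<ge> 1" "4 * b \<le> M" and S: "S \<subseteq> {..b}"
    and pS: "set_pmf p \<subseteq> S" and qS: "set_pmf q \<subseteq> S"
    and mom: "\<And>k. k \<le> r \<Longrightarrow> (\<Sum>x\<in>S. (pmf p x - pmf q x) * real x ^ k) = 0"
    and F: "\<And>x. 0 \<le> F x \<and> F x \<le> 1"
  shows "\<bar>measure_pmf.expectation (Pi_pmf {..<M} 0 (\<lambda>_. p)) (\<lambda>f. sample_mean m {..M} F (weights M f))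
      - measure_pmf.expectation (Pi_pmf {..<M} 0 (\<lambda>_. q)) (\<lambda>f. sample_mean m {..M} F (weights M f))\<bar>
    \<le> real M * (2 * exp (8 * real m * real b / real M) * (1/2) ^ r)"
proof -
  \<comment> \<open>The largest weight \<open>b / M\<close> is then \<open>R / 2\<close>, as the
    annihilator bound requires, and \<open>4 * b \<le> M\<close> keeps the circle of radius
    \<open>R\<close> at distance at least 1/2 from the pole.\<close>
  define R where "R = 2 * real b / real M"
  have finS: "finite S" using S finite_subset by blast
  have R: "0 < R" "R \<le> 1 / 2"
  proof -
    show "0 < R" using M b by (simp add: R_def)
    have "4 * real b \<le> real M" using b(2) by linarith
    then show "R \<le> 1 / 2" using M by (simp add: R_def divide_simps)
  qed
  have fin: "finite (set_pmf p)" "finite (set_pmf q)" using pS qS finS finite_subset by auto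
  have E: "measure_pmf.expectation p u = (\<Sum>x\<in>S. pmf p x * u x)"
    "measure_pmf.expectation q u = (\<Sum>x\<in>S. pmf q x * u x)" for u :: "nat \<Rightarrow> real"
    using integral_measure_pmf_real[OF finS, of p u] integral_measure_pmf_real[OF finS, of q u] pS qS
    by (auto simp: mult_ac)
  have upd: "weights M (f(i := y)) = (weights M f)(i := real y / real M)" if "i < M" for f i y
    using that by (auto simp: weights_def)
  have tot: "(\<Sum>x\<in>S. \<bar>pmf p x - pmf q x\<bar>) \<le> 2"
  proof -
    have "(\<Sum>x\<in>S. \<bar>pmf p x - pmf q x\<bar>) \<le> (\<Sum>x\<in>S. pmf p x + pmf q x)"
      by (intro sum_mono) (auto simp: abs_le_iff pmf_nonneg add_increasing add_increasing2)
    also have "\<dots> = 2"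
      using sum_pmf_eq_1[OF finS pS] sum_pmf_eq_1[OF finS qS] by (simp add: sum.distrib)
    finally show ?thesis .
  qed
  have base: "(1 + R) / (1 - R) \<le> exp (4 * R)"
  proof -
    have "R * (4 * R) \<le> R * 2" using R by (intro mult_left_mono) auto
    then have "1 + R \<le> (1 + 4 * R) * (1 - R)" by (simp add: algebra_simps)
    then have "(1 + R) / (1 - R) \<le> 1 + 4 * R" using R by (simp add: divide_simps)
    also have "\<dots> \<le> exp (4 * R)" by (rule exp_ge_add_one_self)
    finally show ?thesis .
  qed
  have "\<bar>measure_pmf.expectation (Pi_pmf {..<M} 0 (\<lambda>_. p)) (\<lambda>f. sample_mean m {..M} F (weights M f))
      - measure_pmf.expectation (Pi_pmf {..<M} 0 (\<lambda>_. q)) (\<lambda>f. sample_mean m {..M} F (weights M f))\<bar>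
    \<le> real (card {..<M}) * (2 * exp (8 * real m * real b / real M) * (1/2) ^ r)"
  proof (rule Pi_pmf_hybrid[OF _ fin,
        where h = "\<lambda>f. sample_mean m {..M} F (weights M f)" and J = "{..<M}" and d = 0])
    fix i f assume "i \<in> {..<M}"
    then have i: "i < M" by simp
    let ?h = "\<lambda>y. sample_mean m {..M} F (weights M (f(i := y)))"
    have "\<bar>measure_pmf.expectation p ?h - measure_pmf.expectation q ?h\<bar>
        = \<bar>\<Sum>x\<in>S. (pmf p x - pmf q x) * sample_mean m {..M} F ((weights M f)(i := real x / real M))\<bar>"
      unfolding E upd[OF i] by (simp add: sum_subtractf left_diff_distrib)
    also have "\<dots> \<le> (\<Sum>x\<in>S. \<bar>pmf p x - pmf q x\<bar>) * ((1 + R) / (1 - R)) ^ m * (1/2) ^ r"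
    proof (rule sample_mean_coordinate)
      show "i \<in> {..M}" "\<And>j. 0 \<le> weights M f j" using i by (auto simp: weights_def)
      have "1 = weights M f M" by (simp add: weights_def)
      also have "\<dots> \<le> (\<Sum>j\<in>{..M} - {i}. weights M f j)"
        using i by (intro member_le_sum) (auto simp: weights_def)
      finally show "1 \<le> (\<Sum>j\<in>{..M} - {i}. weights M f j)" .
      show "\<bar>real x / real M\<bar> \<le> R / 2" if "x \<in> S" for x
        using that S by (auto simp: R_def intro!: divide_right_mono)
      show "(\<Sum>x\<in>S. (pmf p x - pmf q x) * (real x / real M) ^ k) = 0" if "k \<le> r" for k
      proof -
        have "(\<Sum>x\<in>S. (pmf p x - pmf q x) * (real x / real M) ^ k)
            = (\<Sum>x\<in>S. (pmf p x - pmf q x) * real x ^ k) / real M ^ k"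
          by (simp add: power_divide sum_divide_distrib)
        then show ?thesis using mom[OF that] by simp
      qed
    qed (use F R in auto)
    also have "\<dots> \<le> 2 * exp (4 * R) ^ m * (1/2) ^ r"
      using tot base R by (intro mult_mono power_mono mult_nonneg_nonneg sum_nonneg zero_le_power) auto
    also have "exp (4 * R) ^ m = exp (8 * real m * real b / real M)"
      by (simp add: exp_of_nat_mult[symmetric] R_def mult_ac)
    finally show "\<bar>measure_pmf.expectation p ?h - measure_pmf.expectation q ?h\<bar>
        \<le> 2 * exp (8 * real m * real b / real M) * (1/2) ^ r" .
  qed simp
  then show ?thesis by simp
qed

subsection \<open>Points in general position and unit balls\<close>

text \<open>Newton's scheme: a new value is corrected by a multiple of the product that vanishes on
  the old nodes. Bounding the coefficients instead of the degree covers the empty set, where the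
  zero polynomial is needed.\<close>

lemma polynomial_interpolation:
  fixes A :: "real set"
  assumes "finite A"
  shows "\<exists>p. (\<forall>i\<ge>card A. coeff p i = 0) \<and> (\<forall>x\<in>A. poly p x = g x)"
  using assms
proof (induction A rule: finite_induct)
  case empty
  show ?case by (rule exI[of _ 0]) simp
next
  case (insert a A)
  then obtain p where p: "\<forall>i\<ge>card A. coeff p i = 0" "\<forall>x\<in>A. poly p x = g x" by auto
  define w where "w = (\<Prod>b\<in>A. [:- b, 1:])"
  have w: "poly w x = (\<Prod>b\<in>A. x - b)" for x by (simp add: w_def poly_prod)
  have "degree w \<le> card A"
    unfolding w_def using degree_prod_sum_le[OF insert.hyps(1), of "\<lambda>b. [:- b, 1:]"] by simp
  then have dw: "coeff w i = 0" if "i \<ge> Suc (card A)" for i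
    using that by (intro coeff_eq_0) simp
  have wa: "poly w a \<noteq> 0" using insert.hyps by (auto simp: w)
  define q where "q = p + smult ((g a - poly p a) / poly w a) w"
  have "coeff q i = 0" if "i \<ge> card (insert a A)" for i
    using that insert.hyps p dw by (simp add: q_def)
  moreover have "poly q x = g x" if "x \<in> insert a A" for x
  proof (cases "x = a")
    case False
    then have "poly w x = 0" using that insert.hyps by (auto simp: w)
    then show ?thesis using False that p by (auto simp: q_def)
  qed (use wa in \<open>simp add: q_def\<close>)
  ultimately show ?case by blast
qed

lemma poly_of_coeffs:
  fixes c :: "nat \<Rightarrow> real"
  obtains q where "\<And>x. poly q x = (\<Sum>l<n. c l * x ^ l)" "degree q \<le> n - 1"
proof
  show "poly (\<Sum>l<n. monom (c l) l) x = (\<Sum>l<n. c l * x ^ l)" for x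
    by (simp add: poly_sum poly_monom)
  show "degree (\<Sum>l<n. monom (c l) l) \<le> n - 1"
    by (rule degree_sum_le) (auto intro: order_trans[OF degree_monom_le])
qed

text \<open>Group the indices into \<open>2 * n\<close> pairs \<open>2 * j\<close>,
  \<open>2 * j + 1\<close>. If both members of a pair are counted, \<open>q\<close> changes sign
  between them and has a root there. Hence at most \<open>n\<close> pairs count twice.\<close>

lemma card_sign_alternations:
  fixes q :: "real poly"
  assumes "degree q \<le> n - 1" "n \<ge> 1"
  shows "card {i. i < 4 * n \<and> (-1) ^ i * poly q (real i) > 0} \<le> 3 * n"
proof -
  define P where "P = {i. i < 4 * n \<and> (-1) ^ i * poly q (real i) > 0}"
  define B where "B = {j. j < 2 * n \<and> 2 * j \<in> P \<and> 2 * j + 1 \<in> P}"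
  have fB: "finite B" by (simp add: B_def)
  have root: "\<exists>x. 2 * real j < x \<and> x < 2 * real j + 1 \<and> poly q x = 0" if "j \<in> B" for j
  proof -
    have "poly q (2 * real j) > 0" "poly q (2 * real j + 1) < 0"
      using that by (auto simp: B_def P_def add.commute)
    then show ?thesis using poly_IVT_neg[of "2 * real j" "2 * real j + 1" q] by auto
  qed
  then obtain x where x: "\<And>j. j \<in> B \<Longrightarrow> 2 * real j < x j \<and> x j < 2 * real j + 1 \<and> poly q (x j) = 0"
    by metis
  have card_B: "card B \<le> n"
  proof (cases "B = {}")
    case False
    then obtain j where "j \<in> B" by auto
    then have q0: "q \<noteq> 0" by (auto simp: B_def P_def)
    have "inj_on x B"
    proof (rule inj_onI)
      fix i j assume "i \<in> B" "j \<in> B" "x i = x j"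
      then have "2 * real i < 2 * real j + 1" "2 * real j < 2 * real i + 1" using x[of i] x[of j] by auto
      then show "i = j" by linarith
    qed
    then have "card B = card (x ` B)" by (simp add: card_image)
    also have "\<dots> \<le> card {z. poly q z = 0}"
      using x poly_roots_finite[OF q0] by (intro card_mono) auto
    also have "\<dots> \<le> degree q" by (rule card_poly_roots_bound[OF q0])
    finally show ?thesis using assms by simp
  qed simp
  have "P \<subseteq> (\<lambda>j. if 2 * j \<in> P then 2 * j else 2 * j + 1) ` {..<2 * n} \<union> (\<lambda>j. 2 * j + 1) ` B"
  proof
    fix i assume i: "i \<in> P"
    then have i4: "i < 4 * n" by (simp add: P_def)
    show "i \<in> (\<lambda>j. if 2 * j \<in> P then 2 * j else 2 * j + 1) ` {..<2 * n} \<union> (\<lambda>j. 2 * j + 1) ` B"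
    proof (cases "2 * (i div 2) = i \<or> 2 * (i div 2) \<notin> P")
      case True
      have "i = 2 * (i div 2) \<or> i = 2 * (i div 2) + 1" by linarith
      then have "i = (\<lambda>j. if 2 * j \<in> P then 2 * j else 2 * j + 1) (i div 2)"
        using True i by auto
      moreover have "i div 2 < 2 * n" using i4 by simp
      ultimately show ?thesis by blast
    next
      case False
      then have i_eq: "i = 2 * (i div 2) + 1" by linarith
      then have "i div 2 \<in> B" using False i i4 by (simp add: B_def)
      with i_eq show ?thesis by blast
    qed
  qed
  then have "card P \<le> card ((\<lambda>j. if 2 * j \<in> P then 2 * j else 2 * j + 1) ` {..<2 * n} \<union> (\<lambda>j. 2 * j + 1) ` B)"
    using fB by (intro card_mono) auto
  also have "\<dots> \<le> card {..<2 * n} + card B"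
    using fB by (intro order_trans[OF card_Un_le] add_mono card_image_le) auto
  finally show ?thesis using card_B by (simp add: P_def)
qed

text \<open>If a vector is read as the coefficients of a polynomial q of degree below
  \<open>n\<close>, its inner product with this unit vector has the sign of (-1)^i q(i). Half-spaces
  through the origin thus become sign conditions on polynomials.\<close>

definition curve :: "nat \<Rightarrow> nat \<Rightarrow> nat \<Rightarrow> real" where
  "curve n i l = (-1) ^ i * real i ^ l / L2_set (\<lambda>l. real i ^ l) {..<n}"

lemma curve_norm_ge:
  assumes "n \<ge> 1"
  shows "L2_set (\<lambda>l. real i ^ l) {..<n} \<ge> 1"
  using member_le_L2_set[of "{..<n}" 0 "\<lambda>l. real i ^ l"] assms by simp

lemma L2_set_curve:
  assumes "n \<ge> 1"
  shows "L2_set (curve n i) {..<n} = 1"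
proof -
  let ?N = "L2_set (\<lambda>l. real i ^ l) {..<n}"
  have "(curve n i l)\<^sup>2 = ((1 / ?N) * real i ^ l)\<^sup>2" for l
  proof -
    have "((-1) ^ i)\<^sup>2 = (1 :: real)" by (cases "even i") auto
    then show ?thesis by (simp add: curve_def power_mult_distrib power_divide)
  qed
  then have "L2_set (curve n i) {..<n} = L2_set (\<lambda>l. (1 / ?N) * real i ^ l) {..<n}"
    by (simp only: L2_set_def[of "curve n i"] L2_set_def[of "\<lambda>l. (1 / ?N) * real i ^ l"])
  also have "\<dots> = (1 / ?N) * ?N" by (subst L2_set_right_distrib) auto
  also have "\<dots> = 1" using curve_norm_ge[OF assms, of i] by auto
  finally show ?thesis .
qed

lemma sum_curve_squares:
  assumes "n \<ge> 1"
  shows "(\<Sum>l<n. (curve n i l)\<^sup>2) = 1"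
  using L2_set_curve[OF assms, of i] by (simp add: L2_set_def)

lemma sum_square_diff:
  fixes a b :: "nat \<Rightarrow> real"
  shows "(\<Sum>l<n. (a l - b l)\<^sup>2) = (\<Sum>l<n. (a l)\<^sup>2) - 2 * (\<Sum>l<n. a l * b l) + (\<Sum>l<n. (b l)\<^sup>2)"
  by (simp add: power2_diff sum.distrib sum_subtractf sum_distrib_left algebra_simps)

text \<open>Interpolating the signs (-1)^i on \<open>A\<close> gives a vector \<open>y\<close> with
  positive inner product with every chosen point. Moving the centre from 0 a little along
  \<open>y\<close> brings all these unit vectors strictly inside the ball. The norm bound on
  \<open>c\<close> keeps the origin in the ball; the extra atom will sit there.\<close>

lemma curve_subset_in_open_ball:
  assumes n: "n \<ge> 1" and A: "finite A" "card A \<le> n"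
  shows "\<exists>c. L2_set c {..<n} \<le> 1 \<and> (\<forall>i\<in>A. L2_set (\<lambda>l. curve n i l - c l) {..<n} < 1)"
proof -
  define N where "N i = L2_set (\<lambda>l. real i ^ l) {..<n}" for i
  have N: "N i \<ge> 1" for i using curve_norm_ge[OF n] by (simp add: N_def)
  have "card (real ` A) = card A" by (rule card_image) auto
  \<comment> \<open>Interpolation takes place over the reals, so the exponent \<open>i\<close> is
    recovered from \<open>real i\<close> by the floor.\<close>
  then obtain p where p: "\<forall>i\<ge>card A. coeff p i = 0" "\<forall>x\<in>real ` A. poly p x = (-1) ^ nat \<lfloor>x\<rfloor>"
    using polynomial_interpolation[of "real ` A" "\<lambda>x. (-1) ^ nat \<lfloor>x\<rfloor>"] A by auto
  define y where "y = coeff p"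
  have poly: "poly p x = (\<Sum>l<n. y l * x ^ l)" for x
  proof -
    have "poly p x = (\<Sum>l\<le>degree p. coeff p l * x ^ l)" by (rule poly_altdef)
    also have "\<dots> = (\<Sum>l\<in>{..degree p} \<union> {..<n}. coeff p l * x ^ l)"
      by (rule sum.mono_neutral_left) (auto simp: coeff_eq_0 not_le)
    also have "\<dots> = (\<Sum>l<n. coeff p l * x ^ l)"
      using p A by (intro sum.mono_neutral_right) (auto simp: not_less)
    finally show ?thesis by (simp add: y_def)
  qed
  have dot: "(\<Sum>l<n. curve n i l * y l) = 1 / N i" if "i \<in> A" for i
  proof -
    have "(\<Sum>l<n. curve n i l * y l) = (-1) ^ i / N i * (\<Sum>l<n. y l * real i ^ l)"
      unfolding sum_distrib_left by (rule sum.cong) (auto simp: curve_def N_def)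
    also have "(\<Sum>l<n. y l * real i ^ l) = (-1) ^ i" using p(2) that poly[symmetric] by auto
    finally show ?thesis by (simp add: power_mult_distrib[symmetric])
  qed
  define Y where "Y = (\<Sum>l<n. (y l)\<^sup>2)"
  have Y: "Y \<ge> 0" by (simp add: Y_def sum_nonneg)
  \<comment> \<open>The 1 in the minimum takes care of an empty \<open>A\<close> and yields
    \<open>\<eta> * Y < 1\<close>, hence the norm bound on \<open>c\<close>.\<close>
  define g where "g = Min (insert 1 ((\<lambda>i. 1 / N i) ` A))"
  have fin: "finite (insert 1 ((\<lambda>i. 1 / N i) ` A))" using A by simp
  have g: "0 < g" "g \<le> 1" "\<And>i. i \<in> A \<Longrightarrow> g \<le> 1 / N i"
    unfolding g_def using fin N by (auto simp: less_le_trans[OF zero_less_one])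
  define \<eta> where "\<eta> = g / (Y + 1)"
  have \<eta>: "\<eta> > 0" "\<eta> * Y < g" "\<eta> \<le> 1"
    using g Y by (auto simp: \<eta>_def divide_simps algebra_simps)
  then have "\<eta> * Y \<le> 1" using g by linarith
  define c where "c l = \<eta> * y l" for l
  have cc: "(\<Sum>l<n. (c l)\<^sup>2) = \<eta> * (\<eta> * Y)"
    by (simp add: c_def Y_def power_mult_distrib sum_distrib_left power2_eq_square mult_ac)
  have "L2_set c {..<n} \<le> 1"
    unfolding L2_set_def cc using \<eta> Y \<open>\<eta> * Y \<le> 1\<close> by (auto intro: mult_le_one)
  moreover have "L2_set (\<lambda>l. curve n i l - c l) {..<n} < 1" if "i \<in> A" for i
  proof -
    have "(\<Sum>l<n. curve n i l * c l) = \<eta> * (\<Sum>l<n. curve n i l * y l)"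
      by (simp add: c_def sum_distrib_left mult_ac)
    then have "(\<Sum>l<n. (curve n i l - c l)\<^sup>2) = 1 - 2 * (\<eta> * (1 / N i)) + \<eta> * (\<eta> * Y)"
      unfolding sum_square_diff sum_curve_squares[OF n] cc using dot[OF that] by simp
    also have "\<dots> < 1"
    proof -
      have "\<eta> * (\<eta> * Y) < \<eta> * (1 / N i)" using \<eta> g(3)[OF that] by (intro mult_strict_left_mono) auto
      moreover have "0 < \<eta> * (1 / N i)" using \<eta> N[of i] by (intro mult_pos_pos) auto
      ultimately show ?thesis by linarith
    qed
    finally show ?thesis by (simp add: L2_set_def)
  qed
  ultimately show ?thesis by blast
qed

text \<open>
  The points lie on the moment curve, with alternating signs, projected to a sphere of radius
  slightly larger than 1. Any \<open>n\<close> of them lie in an open hemisphere, but a hemisphere contains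
  two consecutive points only if a polynomial of degree less than \<open>n\<close> has a root in between.
\<close>

lemma ball_configuration:
  assumes n: "n \<ge> 1"
  shows "\<exists>v :: nat \<Rightarrow> nat \<Rightarrow> real. (\<forall>i. L2_set (v i) {..<n} \<le> 2)
    \<and> (\<forall>A. A \<subseteq> {..<4 * n} \<and> card A \<le> n \<longrightarrow>
       (\<exists>c. L2_set c {..<n} \<le> 1 \<and> (\<forall>i\<in>A. L2_set (\<lambda>l. v i l - c l) {..<n} \<le> 1)))
    \<and> (\<forall>c. card {i. i < 4 * n \<and> L2_set (\<lambda>l. c l - v i l) {..<n} \<le> 1} \<le> 3 * n)"
proof -
  define \<A> where "\<A> = {A. A \<subseteq> {..<4 * n} \<and> card A \<le> n}"
  have fin\<A>: "finite \<A>" unfolding \<A>_def by (rule finite_subset[of _ "Pow {..<4 * n}"]) auto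
  have finA: "finite A" if "A \<in> \<A>" for A using that finite_subset by (auto simp: \<A>_def)
  have "\<exists>c. L2_set c {..<n} \<le> 1 \<and> (\<forall>i\<in>A. L2_set (\<lambda>l. curve n i l - c l) {..<n} < 1)" if "A \<in> \<A>" for A
    using curve_subset_in_open_ball[OF n finA[OF that]] that by (auto simp: \<A>_def)
  then obtain c where c: "\<And>A. A \<in> \<A> \<Longrightarrow> L2_set (c A) {..<n} \<le> 1"
    "\<And>A i. A \<in> \<A> \<Longrightarrow> i \<in> A \<Longrightarrow> L2_set (\<lambda>l. curve n i l - c A l) {..<n} < 1" by metis
  \<comment> \<open>The finitely many strict inequalities leave a uniform slack
    \<open>\<gamma>\<close>; enlarging the sphere to radius \<open>1 + \<gamma>\<close> uses up
    exactly this slack. The inserted 0 makes the maximum meaningful and gives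
    \<open>\<gamma> \<le> 1\<close>.\<close>
  define T where "T = insert 0 ((\<lambda>(A, i). L2_set (\<lambda>l. curve n i l - c A l) {..<n}) ` (SIGMA A:\<A>. A))"
  have finT: "finite T" unfolding T_def using fin\<A> finA by auto
  have T: "T \<noteq> {}" by (simp add: T_def)
  define \<gamma> where "\<gamma> = 1 - Max T"
  have "Max T < 1" using Max_in[OF finT T] c(2) by (auto simp: T_def)
  moreover have "0 \<le> Max T" using finT by (intro Max_ge) (auto simp: T_def)
  ultimately have \<gamma>: "0 < \<gamma>" "\<gamma> \<le> 1" by (auto simp: \<gamma>_def)
  define v where "v i l = (1 + \<gamma>) * curve n i l" for i l
  have norm_v: "L2_set (v i) {..<n} = 1 + \<gamma>" for i
  proof -
    have "L2_set (v i) {..<n} = (1 + \<gamma>) * L2_set (curve n i) {..<n}"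
      unfolding v_def using \<gamma> by (intro L2_set_right_distrib[symmetric]) simp
    then show ?thesis using L2_set_curve[OF n] by simp
  qed
  show ?thesis
  proof (rule exI[of _ v], intro conjI allI impI)
    show "L2_set (v i) {..<n} \<le> 2" for i using norm_v \<gamma> by simp
  next
    fix A assume "A \<subseteq> {..<4 * n} \<and> card A \<le> n"
    then have A: "A \<in> \<A>" by (simp add: \<A>_def)
    have "L2_set (\<lambda>l. v i l - c A l) {..<n} \<le> 1" if "i \<in> A" for i
    proof -
      have "L2_set (\<lambda>l. v i l - c A l) {..<n} = L2_set (\<lambda>l. (curve n i l - c A l) + \<gamma> * curve n i l) {..<n}"
        by (simp add: v_def algebra_simps)
      also have "\<dots> \<le> L2_set (\<lambda>l. curve n i l - c A l) {..<n} + L2_set (\<lambda>l. \<gamma> * curve n i l) {..<n}"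
        by (rule L2_set_triangle_ineq)
      also have "L2_set (\<lambda>l. \<gamma> * curve n i l) {..<n} = \<gamma>"
        using L2_set_right_distrib[of \<gamma> "curve n i" "{..<n}"] L2_set_curve[OF n] \<gamma> by simp
      also have "L2_set (\<lambda>l. curve n i l - c A l) {..<n} \<le> Max T"
        using A that finT by (intro Max_ge) (auto simp: T_def)
      finally show ?thesis by (simp add: \<gamma>_def)
    qed
    then show "\<exists>c. L2_set c {..<n} \<le> 1 \<and> (\<forall>i\<in>A. L2_set (\<lambda>l. v i l - c l) {..<n} \<le> 1)"
      using c(1)[OF A] by blast
  next
    fix c :: "nat \<Rightarrow> real"
    obtain q where q: "\<And>x. poly q x = (\<Sum>l<n. c l * x ^ l)" "degree q \<le> n - 1"
      using poly_of_coeffs by blast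
    have "{i. i < 4 * n \<and> L2_set (\<lambda>l. c l - v i l) {..<n} \<le> 1}
        \<subseteq> {i. i < 4 * n \<and> (-1) ^ i * poly q (real i) > 0}"
    proof safe
      fix i assume "L2_set (\<lambda>l. c l - v i l) {..<n} \<le> 1"
      then have "(\<Sum>l<n. (c l - v i l)\<^sup>2) \<le> 1" by (simp add: L2_set_def)
      moreover have "(\<Sum>l<n. (v i l)\<^sup>2) = (1 + \<gamma>)\<^sup>2"
        using norm_v[of i] by (metis L2_set_def real_sqrt_pow2 sum_nonneg zero_le_power2)
      moreover have "1 < (1 + \<gamma>)\<^sup>2" using \<gamma> by (simp add: power2_eq_square algebra_simps add_pos_nonneg)
      moreover have "0 \<le> (\<Sum>l<n. (c l)\<^sup>2)" by (simp add: sum_nonneg)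
      \<comment> \<open>A point of norm above 1 within distance 1 of \<open>c\<close> has positive
        inner product with \<open>c\<close>.\<close>
      ultimately have pos: "(\<Sum>l<n. c l * v i l) > 0" unfolding sum_square_diff by linarith
      define N where "N = L2_set (\<lambda>l. real i ^ l) {..<n}"
      have "(\<Sum>l<n. c l * v i l) = (1 + \<gamma>) / N * ((-1) ^ i * poly q (real i))"
        unfolding q sum_distrib_left by (rule sum.cong) (auto simp: v_def curve_def N_def)
      moreover have "(1 + \<gamma>) / N > 0" using \<gamma> curve_norm_ge[OF n, of i] by (simp add: N_def)
      ultimately show "(-1) ^ i * poly q (real i) > 0" using pos zero_less_mult_pos by metis
    qed
    then have "card {i. i < 4 * n \<and> L2_set (\<lambda>l. c l - v i l) {..<n} \<le> 1}
        \<le> card {i. i < 4 * n \<and> (-1) ^ i * poly q (real i) > 0}"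
      by (intro card_mono) auto
    also have "\<dots> \<le> 3 * n" by (rule card_sign_alternations[OF q(2) n])
    finally show "card {i. i < 4 * n \<and> L2_set (\<lambda>l. c l - v i l) {..<n} \<le> 1} \<le> 3 * n" .
  qed
qed

text \<open>Split off \<open>n\<close> elements at a time, with one centre per full chunk and one
  for the rest. The rest gets a centre even when it is empty, so \<open>C\<close> is never empty; a
  group without points of \<open>A\<close> can still cover the extra atom.\<close>

lemma finite_cover_by_chunks:
  assumes n: "n \<ge> 1" and A: "finite A"
    and R: "\<And>B. B \<subseteq> A \<Longrightarrow> card B \<le> n \<Longrightarrow> \<exists>c. Q c \<and> (\<forall>i\<in>B. R i c)"
  shows "\<exists>C. finite C \<and> C \<noteq> {} \<and> card C \<le> card A div n + 1 \<and> (\<forall>c\<in>C. Q c) \<and> (\<forall>i\<in>A. \<exists>c\<in>C. R i c)"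
  using A R
proof (induction "card A" arbitrary: A rule: less_induct)
  case less
  show ?case
  proof (cases "card A < n")
    case True
    then obtain c where "Q c" "\<forall>i\<in>A. R i c" using less.prems(2)[of A] by auto
    then show ?thesis by (intro exI[of _ "{c}"]) auto
  next
    case False
    then obtain B where B: "B \<subseteq> A" "card B = n" by (meson not_less obtain_subset_with_card_n)
    have fB: "finite B" using B less.prems(1) finite_subset by blast
    obtain c where c: "Q c" "\<forall>i\<in>B. R i c" using less.prems(2)[of B] B by auto
    have card: "card (A - B) = card A - n" using B fB by (simp add: card_Diff_subset)
    have "\<exists>C. finite C \<and> C \<noteq> {} \<and> card C \<le> card (A - B) div n + 1 \<and> (\<forall>c\<in>C. Q c) \<and> (\<forall>i\<in>A - B. \<exists>c\<in>C. R i c)"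
    proof (rule less.hyps)
      show "card (A - B) < card A" using False n card by linarith
      show "finite (A - B)" using less.prems(1) by simp
      show "\<exists>c. Q c \<and> (\<forall>i\<in>D. R i c)" if "D \<subseteq> A - B" "card D \<le> n" for D
        using less.prems(2)[of D] that by blast
    qed
    then obtain C where C: "finite C" "card C \<le> card (A - B) div n + 1" "\<forall>c\<in>C. Q c" "\<forall>i\<in>A - B. \<exists>c\<in>C. R i c"
      by blast
    have "card (insert c C) \<le> card A div n + 1"
    proof -
      have "card (insert c C) \<le> Suc (card C)" using C(1) by (simp add: card_insert_if)
      also have "\<dots> \<le> Suc (card (A - B) div n + 1)" using C(2) by simp
      also have "card (A - B) div n + 1 = card A div n"
        using False n unfolding card by (simp add: le_div_geq)
      finally show ?thesis by simp
    qed
    then show ?thesis using C c by (intro exI[of _ "insert c C"]) auto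
  qed
qed

lemma abs_member_le_L2_set:
  assumes "finite A" "i \<in> A"
  shows "\<bar>f i\<bar> \<le> L2_set f A"
  using member_le_L2_set[OF assms, of "\<lambda>i. \<bar>f i\<bar>"] by (simp add: L2_set_def)

lemma sum_div_le:
  fixes f :: "'b \<Rightarrow> nat"
  assumes "n \<ge> 1"
  shows "(\<Sum>i\<in>A. f i div n) \<le> (\<Sum>i\<in>A. f i) div n"
proof -
  have "(\<Sum>i\<in>A. f i div n) * n \<le> (\<Sum>i\<in>A. f i)"
    unfolding sum_distrib_right by (rule sum_mono) simp
  then show ?thesis using assms by (simp add: less_eq_div_iff_mult_less_eq)
qed

text \<open>
  Copies of \<open>ball_configuration\<close> at mutual distance more than 2. One ball in twenty is reserved
  for the copies that meet \<open>A\<close> in more than \<open>n\<close> points. The index \<open>M\<close> is the centre of copy 0.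
\<close>

lemma cluster_configuration:
  fixes n k :: nat
  assumes n: "n \<ge> 1" and k: "k \<ge> 1"
  defines "M \<equiv> 4 * n * (k - k div 20)"
  shows "\<exists>pt :: nat \<Rightarrow> nat \<Rightarrow> real. (\<forall>i. pt i \<in> space (euclid n))
    \<and> (\<forall>A. A \<subseteq> {..<M} \<and> 20 * card A \<le> n * k \<longrightarrow>
      (\<exists>c. (\<forall>j<k. c j \<in> space (euclid n)) \<and> (\<forall>i\<in>insert M A. \<exists>j<k. pt i \<in> unit_ball n (c j))))
    \<and> (\<forall>c. card {i. i < M \<and> (\<exists>j<k. pt i \<in> unit_ball n (c j))} \<le> 3 * n * k)"
proof -
  define G where "G = k - k div 20"
  have G: "G \<ge> 1" using k by (simp add: G_def)
  have M: "M = 4 * n * G" by (simp add: M_def G_def)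
  have space: "space (euclid n) = {..<n} \<rightarrow>\<^sub>E UNIV" by (simp add: euclid_def space_PiM)
  obtain v :: "nat \<Rightarrow> nat \<Rightarrow> real" where v2: "\<forall>i. L2_set (v i) {..<n} \<le> 2"
    and vcov: "\<forall>A. A \<subseteq> {..<4 * n} \<and> card A \<le> n \<longrightarrow>
       (\<exists>c. L2_set c {..<n} \<le> 1 \<and> (\<forall>i\<in>A. L2_set (\<lambda>l. v i l - c l) {..<n} \<le> 1))"
    and vcard: "\<forall>c. card {i. i < 4 * n \<and> L2_set (\<lambda>l. c l - v i l) {..<n} \<le> 1} \<le> 3 * n"
    using ball_configuration[OF n] by blast
  \<comment> \<open>Points have norm at most 2 before the shift, so the first coordinate of a ball's
    centre is within 3 of the shift of every copy it meets. Shifts differ by at least 10, so a ball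
    meets only one copy.\<close>
  define sh :: "nat \<Rightarrow> nat \<Rightarrow> real" where "sh g l = (if l = 0 then 10 * real g else 0)" for g l
  define pt where "pt i = (if i < M then (\<lambda>l\<in>{..<n}. v (i mod (4 * n)) l + sh (i div (4 * n)) l)
    else (\<lambda>l\<in>{..<n}. 0))" for i
  have in_ball: "pt i \<in> unit_ball n c \<longleftrightarrow> L2_set (\<lambda>l. c l - pt i l) {..<n} \<le> 1" for i c
    by (auto simp: unit_ball_def l2_dist_def space pt_def)
  have in_ball_lt: "pt i \<in> unit_ball n c \<longleftrightarrow>
      L2_set (\<lambda>l. (c l - sh (i div (4 * n)) l) - v (i mod (4 * n)) l) {..<n} \<le> 1" if "i < M" for i c
  proof -
    have "L2_set (\<lambda>l. c l - pt i l) {..<n} = L2_set (\<lambda>l. (c l - sh (i div (4 * n)) l) - v (i mod (4 * n)) l) {..<n}"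
      by (rule L2_set_cong) (use that in \<open>auto simp: pt_def\<close>)
    then show ?thesis by (simp add: in_ball)
  qed
  show ?thesis
  proof (rule exI[of _ pt], intro conjI allI impI)
    show "pt i \<in> space (euclid n)" for i by (simp add: space pt_def)
  next
    fix A assume "A \<subseteq> {..<M} \<and> 20 * card A \<le> n * k"
    then have A: "A \<subseteq> {..<M}" "20 * card A \<le> n * k" by auto
    have finA: "finite A" using A finite_subset by blast
    define grp where "grp g = {i\<in>A. i div (4 * n) = g}" for g
    have cover: "\<exists>C. finite C \<and> C \<noteq> {} \<and> card C \<le> card (grp g) div n + 1 \<and> (\<forall>c\<in>C. L2_set c {..<n} \<le> 1)
        \<and> (\<forall>i\<in>grp g. \<exists>c\<in>C. L2_set (\<lambda>l. v (i mod (4 * n)) l - c l) {..<n} \<le> 1)" for g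
    proof (rule finite_cover_by_chunks[OF n])
      show "finite (grp g)" using finA by (simp add: grp_def)
      fix B assume B: "B \<subseteq> grp g" "card B \<le> n"
      have "card ((\<lambda>i. i mod (4 * n)) ` B) \<le> n"
        using B finA by (intro order_trans[OF card_image_le]) (auto intro: finite_subset simp: grp_def)
      moreover have "(\<lambda>i. i mod (4 * n)) ` B \<subseteq> {..<4 * n}" using n by auto
      ultimately show "\<exists>c. L2_set c {..<n} \<le> 1 \<and> (\<forall>i\<in>B. L2_set (\<lambda>l. v (i mod (4 * n)) l - c l) {..<n} \<le> 1)"
        using vcov[rule_format, of "(\<lambda>i. i mod (4 * n)) ` B"] by auto
    qed
    from choice[OF allI[OF cover]] obtain C where
      "\<forall>g. finite (C g) \<and> C g \<noteq> {} \<and> card (C g) \<le> card (grp g) div n + 1 \<and> (\<forall>c\<in>C g. L2_set c {..<n} \<le> 1)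
        \<and> (\<forall>i\<in>grp g. \<exists>c\<in>C g. L2_set (\<lambda>l. v (i mod (4 * n)) l - c l) {..<n} \<le> 1)"
      by (rule exE)
    then have C: "\<And>g. finite (C g)" "\<And>g. C g \<noteq> {}" "\<And>g. card (C g) \<le> card (grp g) div n + 1"
      "\<And>g c. c \<in> C g \<Longrightarrow> L2_set c {..<n} \<le> 1"
      "\<And>g i. i \<in> grp g \<Longrightarrow> \<exists>c\<in>C g. L2_set (\<lambda>l. v (i mod (4 * n)) l - c l) {..<n} \<le> 1"
      by simp_all
    define ctr where "ctr g c = (\<lambda>l\<in>{..<n}. c l + sh g l)" for g c
    define CC where "CC = (\<Union>g<G. ctr g ` C g)"
    have finCC: "finite CC" using C(1) by (simp add: CC_def)
    have neCC: "CC \<noteq> {}" using C(2) G by (auto simp: CC_def intro!: exI[of _ 0])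
    \<comment> \<open>Each of the \<open>G\<close> groups needs one centre, plus one for each full
      chunk of \<open>n\<close> points of \<open>A\<close>. There are at most
      \<open>card A div n \<le> k div 20\<close> full chunks, which is the reserve
      \<open>k - G\<close>.\<close>
    have "card CC \<le> (\<Sum>g<G. card (ctr g ` C g))" unfolding CC_def by (rule card_UN_le) simp
    also have "\<dots> \<le> (\<Sum>g<G. card (grp g) div n + 1)"
      using C(1,3) by (intro sum_mono order_trans[OF card_image_le]) auto
    also have "\<dots> = (\<Sum>g<G. card (grp g) div n) + G" by (simp only: sum.distrib) simp
    also have "(\<Sum>g<G. card (grp g) div n) \<le> (\<Sum>g<G. card (grp g)) div n" by (rule sum_div_le[OF n])
    also have "(\<Sum>g<G. card (grp g)) = card (\<Union>g<G. grp g)"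
      using finA by (intro card_UN_disjoint[symmetric]) (auto simp: grp_def)
    also have "(\<Union>g<G. grp g) = A"
      using A(1) n by (auto simp: grp_def M less_mult_imp_div_less mult.commute)
    also have "card A div n \<le> k div 20"
    proof -
      have "20 * (card A div n) * n \<le> 20 * card A" by simp
      also note A(2)
      finally have "20 * (card A div n) \<le> k" using n by (simp add: mult.commute)
      then show ?thesis by linarith
    qed
    finally have cardCC: "card CC \<le> k" by (simp add: G_def)
    obtain e where e: "bij_betw e {0..<card CC} CC" using ex_bij_betw_nat_finite[OF finCC] by blast
    \<comment> \<open>Exactly \<open>k\<close> centres are required, so the list is padded with a
      repeated one.\<close>
    define c where "c j = (if j < card CC then e j else e 0)" for j
    have pos: "card CC > 0" using finCC neCC by (simp add: card_gt_0_iff)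
    have cCC: "c j \<in> CC" for j
      using e pos by (auto simp: c_def bij_betw_def)
    have surj: "\<exists>j<k. z = c j" if "z \<in> CC" for z
    proof -
      have "z \<in> e ` {0..<card CC}" using that e by (simp add: bij_betw_def)
      then obtain j where "j < card CC" "z = e j" by auto
      then show ?thesis using cardCC by (intro exI[of _ j]) (auto simp: c_def)
    qed
    have "\<exists>j<k. pt i \<in> unit_ball n (c j)" if i: "i \<in> insert M A" for i
    proof -
      have "\<exists>z\<in>CC. pt i \<in> unit_ball n z"
      proof (cases "i < M")
        case True
        define g where "g = i div (4 * n)"
        have g: "g < G" using True n by (simp add: g_def M less_mult_imp_div_less mult.commute)
        have "i \<in> grp g" using True i by (auto simp: grp_def g_def)
        then obtain z where z: "z \<in> C g" "L2_set (\<lambda>l. v (i mod (4 * n)) l - z l) {..<n} \<le> 1"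
          using C(5) by blast
        have "L2_set (\<lambda>l. (ctr g z l - sh g l) - v (i mod (4 * n)) l) {..<n}
            = L2_set (\<lambda>l. v (i mod (4 * n)) l - z l) {..<n}"
          unfolding L2_set_def by (simp add: ctr_def power2_commute)
        then have "pt i \<in> unit_ball n (ctr g z)" using z(2) in_ball_lt[OF True] by (simp add: g_def)
        then show ?thesis using z(1) g by (auto simp: CC_def)
      next
        case False
        obtain z where z: "z \<in> C 0" using C(2) by blast
        have "L2_set (\<lambda>l. ctr 0 z l - pt i l) {..<n} = L2_set z {..<n}"
          by (rule L2_set_cong) (use False in \<open>auto simp: ctr_def pt_def sh_def\<close>)
        then have "pt i \<in> unit_ball n (ctr 0 z)" using C(4)[OF z] by (simp add: in_ball)
        then show ?thesis using z G by (auto simp: CC_def)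
      qed
      then show ?thesis using surj by blast
    qed
    moreover have "c j \<in> space (euclid n)" for j
    proof -
      have "ctr g z \<in> space (euclid n)" for g z by (simp add: space ctr_def)
      then show ?thesis using cCC[of j] by (auto simp: CC_def)
    qed
    ultimately show "\<exists>c. (\<forall>j<k. c j \<in> space (euclid n)) \<and> (\<forall>i\<in>insert M A. \<exists>j<k. pt i \<in> unit_ball n (c j))"
      by blast
  next
    fix c :: "nat \<Rightarrow> nat \<Rightarrow> real"
    define W where "W z = {i. i < M \<and> pt i \<in> unit_ball n z}" for z
    have finW: "finite (W z)" for z by (rule finite_subset[of _ "{..<M}"]) (auto simp: W_def)
    have "card (W z) \<le> 3 * n" for z
    proof (cases "W z = {}")
      case False
      then obtain i0 where i0: "i0 \<in> W z" by auto
      define g where "g = i0 div (4 * n)"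
      have close: "\<bar>z 0 - 10 * real (i div (4 * n))\<bar> \<le> 3" if "i \<in> W z" for i
      proof -
        have "\<bar>(z 0 - sh (i div (4 * n)) 0) - v (i mod (4 * n)) 0\<bar> \<le> 1"
          using in_ball_lt[of i z] that n
            abs_member_le_L2_set[of "{..<n}" 0 "\<lambda>l. (z l - sh (i div (4 * n)) l) - v (i mod (4 * n)) l"]
          by (auto simp: W_def)
        moreover have "\<bar>v (i mod (4 * n)) 0\<bar> \<le> 2"
          using n v2[rule_format, of "i mod (4 * n)"] abs_member_le_L2_set[of "{..<n}" 0 "v (i mod (4 * n))"]
          by auto
        ultimately show ?thesis by (simp add: sh_def)
      qed
      have same: "i div (4 * n) = g" if "i \<in> W z" for i
      proof -
        have "\<bar>10 * real (i div (4 * n)) - 10 * real g\<bar> \<le> 6"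
          using close[OF that] close[OF i0] unfolding g_def by linarith
        then show ?thesis by linarith
      qed
      have "card (W z) = card ((\<lambda>i. i mod (4 * n)) ` W z)"
        by (rule card_image[symmetric], rule inj_onI) (metis same div_mult_mod_eq)
      also have "\<dots> \<le> card {i. i < 4 * n \<and> L2_set (\<lambda>l. (z l - sh g l) - v i l) {..<n} \<le> 1}"
        using n same in_ball_lt by (intro card_mono) (auto simp: W_def)
      also have "\<dots> \<le> 3 * n" by (rule vcard[rule_format])
      finally show ?thesis .
    qed simp
    then have "(\<Sum>j<k. card (W (c j))) \<le> (\<Sum>j<k. 3 * n)" by (intro sum_mono)
    moreover have "card (\<Union>j<k. W (c j)) \<le> (\<Sum>j<k. card (W (c j)))" by (rule card_UN_le) simp
    moreover have "{i. i < M \<and> (\<exists>j<k. pt i \<in> unit_ball n (c j))} = (\<Union>j<k. W (c j))"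
      by (auto simp: W_def)
    ultimately show "card {i. i < M \<and> (\<exists>j<k. pt i \<in> unit_ball n (c j))} \<le> 3 * n * k"
      by (simp add: mult_ac)
  qed
qed

subsection \<open>Finitely supported distributions\<close>

text \<open>The product measure is carried by the finitely many tuples over \<open>I\<close>. Each
  of these is a measurable atom, being a product of singletons, so the integral is a finite
  sum.\<close>

lemma integral_PiM_pmf:
  fixes g :: "(nat \<Rightarrow> 'i) \<Rightarrow> real"
  assumes I: "finite I" and sub: "set_pmf P \<subseteq> I"
    and g: "g \<in> borel_measurable (PiM {..<m} (\<lambda>_. measure_pmf P))"
  shows "(\<integral>x. g x \<partial>PiM {..<m::nat} (\<lambda>_. measure_pmf P))
    = (\<Sum>x\<in>PiE {..<m} (\<lambda>_. I). g x * (\<Prod>j<m. pmf P (x j)))"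
proof -
  interpret product_prob_space "\<lambda>_. measure_pmf P" "{..<m}"
    by (rule product_prob_spaceI) (rule prob_space_measure_pmf)
  let ?N = "PiM {..<m} (\<lambda>_. measure_pmf P)" and ?\<Omega> = "PiE {..<m} (\<lambda>_. I)"
  have fin: "finite ?\<Omega>" using I by (intro finite_PiE) auto
  have single: "PiE {..<m} (\<lambda>j. {x j}) = {x}" if "x \<in> ?\<Omega>" for x
    using that by (intro PiE_singleton) (auto simp: PiE_def)
  have sets: "{x} \<in> sets ?N" if "x \<in> ?\<Omega>" for x
    unfolding single[OF that, symmetric] by (intro sets_PiM_I_finite) auto
  have meas: "measure ?N {x} = (\<Prod>j<m. pmf P (x j))" if "x \<in> ?\<Omega>" for x
    unfolding single[OF that, symmetric] measure_def
    by (subst emeasure_PiM) (auto simp: emeasure_pmf_single prod_ennreal prod_nonneg)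
  have "emeasure ?N ?\<Omega> = (\<Prod>j<m. emeasure P I)" by (rule emeasure_PiM) auto
  also have "emeasure P I = 1"
  proof -
    have "measure P I = 1"
      using sub by (subst measure_pmf.prob_eq_1) (auto simp: AE_measure_pmf_iff)
    then show ?thesis by (simp add: measure_pmf.emeasure_eq_measure)
  qed
  finally have "emeasure ?N ?\<Omega> = 1" by simp
  then have "AE x in ?N. x \<in> ?\<Omega>"
    by (subst P.prob_eq_1[symmetric]) (auto simp: measure_def intro!: sets_PiM_I_finite)
  then have "(\<integral>x. g x \<partial>?N) = (\<integral>x. g x * indicator ?\<Omega> x \<partial>?N)"
    using g by (intro integral_cong_AE) (auto intro!: borel_measurable_times borel_measurable_indicator sets_PiM_I_finite)
  also have "\<dots> = (\<Sum>x\<in>?\<Omega>. g x * measure ?N {x})"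
    by (rule integral_indicator_finite_real[OF fin sets]) (auto simp: P.emeasure_eq_measure)
  also have "\<dots> = (\<Sum>x\<in>?\<Omega>. g x * (\<Prod>j<m. pmf P (x j)))" using meas by simp
  finally show ?thesis .
qed

text \<open>Samples from the image distribution are images of sampled indices. Passing to indices
  makes the acceptance probability an explicit rational function of the weights and allows several
  indices to share a point.\<close>

lemma output_law_discrete:
  assumes T: "randomized_alg n m T" and pt: "\<And>i. pt i \<in> space (euclid n)"
    and I: "finite I" and P: "\<And>i. pmf P i = (if i \<in> I then w i / (\<Sum>j\<in>I. w j) else 0)"
  shows "measure (output_law m T (distr (measure_pmf P) (euclid n) pt)) {b}
    = sample_mean m I (\<lambda>x. measure (T (\<lambda>j\<in>{..<m}. pt (x j))) {b}) w"
proof -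
  let ?E = "euclid n" and ?D = "distr (measure_pmf P) (euclid n) pt"
  have pt_meas: "pt \<in> measurable (measure_pmf P) ?E" using pt by simp
  have D: "prob_space ?D" using pt_meas by (intro measure_pmf.prob_space_distr)
  interpret PD: prob_space "PiM {..<m} (\<lambda>_. ?D)" by (rule prob_space_PiM) (rule D)
  have T': "T \<in> measurable (PiM {..<m} (\<lambda>_. ?E)) (subprob_algebra (count_space UNIV))"
    using T unfolding randomized_alg_def by (rule measurable_prob_algebraD)
  have setsD: "sets (PiM {..<m} (\<lambda>_. ?D)) = sets (PiM {..<m} (\<lambda>_. ?E))"
    by (intro sets_PiM_cong) auto
  have TD: "T \<in> measurable (PiM {..<m} (\<lambda>_. ?D)) (subprob_algebra (count_space UNIV))"
    using T' setsD measurable_cong_sets by blast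
  have PiM_D: "PiM {..<m} (\<lambda>_. ?D)
      = distr (PiM {..<m} (\<lambda>_. measure_pmf P)) (PiM {..<m} (\<lambda>_. ?E)) (compose {..<m} pt)"
  proof -
    have "PiM {..<m} (\<lambda>_. ?D)
      = distr (PiM {..<m} (\<lambda>_. measure_pmf P)) (PiM {..<m} (\<lambda>_. ?D)) (compose {..<m} pt)"
    proof -
      have "distr (PiM {..<m} (\<lambda>_. measure_pmf P)) (PiM {..<m} (\<lambda>_. ?D)) (compose {..<m} pt)
          = PiM {..<m} (\<lambda>_. distr (measure_pmf P) ?D pt)"
        by (rule distr_PiM_finite_prob_space') (use D pt in \<open>auto simp: prob_space_measure_pmf\<close>)
      moreover have "distr (measure_pmf P) ?D pt = ?D" by (rule distr_cong) auto
      ultimately show ?thesis by simp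
    qed
    also have "\<dots> = distr (PiM {..<m} (\<lambda>_. measure_pmf P)) (PiM {..<m} (\<lambda>_. ?E)) (compose {..<m} pt)"
      by (rule distr_cong) (use setsD in auto)
    finally show ?thesis .
  qed
  have comp: "compose {..<m} pt \<in> measurable (PiM {..<m} (\<lambda>_. measure_pmf P)) (PiM {..<m} (\<lambda>_. ?E))"
    unfolding compose_def
    by (rule measurable_restrict, rule measurable_compose[OF _ pt_meas], rule measurable_component_singleton)
  have mT: "(\<lambda>x. measure (T x) {b}) \<in> borel_measurable (PiM {..<m} (\<lambda>_. ?E))"
    by (rule measurable_compose[OF T' measurable_measure_subprob_algebra]) simp
  have "measure (output_law m T ?D) {b} = (\<integral>x. measure (T x) {b} \<partial>PiM {..<m} (\<lambda>_. ?D))"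
    unfolding output_law_def by (rule PD.measure_bind[OF TD]) simp
  also have "\<dots> = (\<integral>x. measure (T (compose {..<m} pt x)) {b} \<partial>PiM {..<m} (\<lambda>_. measure_pmf P))"
    unfolding PiM_D by (rule integral_distr[OF comp mT])
  also have "\<dots> = (\<Sum>x\<in>PiE {..<m} (\<lambda>_. I). measure (T (compose {..<m} pt x)) {b} * (\<Prod>j<m. pmf P (x j)))"
    using measurable_compose[OF comp mT] P
    by (intro integral_PiM_pmf[OF I]) (auto simp: set_pmf_iff split: if_splits)
  also have "\<dots> = sample_mean m I (\<lambda>x. measure (T (\<lambda>j\<in>{..<m}. pt (x j))) {b}) w"
    unfolding sample_mean_def sum_divide_distrib
    by (rule sum.cong) (auto simp: P compose_def PiE_iff prod_dividef)
  finally show ?thesis .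
qed

lemma distribution_on_distr:
  assumes "\<And>i. pt i \<in> space (euclid n)"
  shows "distribution_on n (distr (measure_pmf P) (euclid n) pt)"
  using assms by (auto simp: distribution_on_def intro!: measure_pmf.prob_space_distr)

lemma open_ball_measurable: "{y \<in> space (euclid n). l2_dist n x y < r} \<in> sets (euclid n)"
  unfolding l2_dist_def L2_set_def euclid_def by measurable

lemma singleton_measurable:
  assumes "x \<in> space (euclid n)"
  shows "{x} \<in> sets (euclid n)"
proof -
  have "PiE {..<n} (\<lambda>i. {x i}) = {x}"
    using assms by (intro PiE_singleton) (auto simp: euclid_def space_PiM PiE_def)
  moreover have "PiE {..<n} (\<lambda>i. {x i}) \<in> sets (euclid n)"
    unfolding euclid_def by (rule sets_PiM_I_finite) auto
  ultimately show ?thesis by simp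
qed

lemma l2_dist_pos:
  assumes "x \<in> space (euclid n)" "y \<in> space (euclid n)" "x \<noteq> y"
  shows "l2_dist n x y > 0"
proof -
  obtain i where "i < n" "x i \<noteq> y i"
    using assms PiE_ext[of x "{..<n}" "\<lambda>_. UNIV" y] by (auto simp: euclid_def space_PiM)
  then have "l2_dist n x y \<noteq> 0" by (auto simp: l2_dist_def L2_set_eq_0_iff)
  moreover have "l2_dist n x y \<ge> 0" by (simp add: l2_dist_def)
  ultimately show ?thesis by simp
qed

text \<open>The topological support contains only atoms: a point off the finite set of images has a
  positive distance \<open>d\<close> to it, and the open ball of radius \<open>d\<close> around it
  has mass 0.\<close>

lemma clusterable_discrete:
  assumes pt: "\<And>i. pt i \<in> space (euclid n)" and fin: "finite (set_pmf P)"
    and c: "\<And>j. j < k \<Longrightarrow> c j \<in> space (euclid n)"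
    and cover: "\<And>i. i \<in> set_pmf P \<Longrightarrow> \<exists>j<k. pt i \<in> unit_ball n (c j)"
  shows "clusterable n k (distr (measure_pmf P) (euclid n) pt)"
proof -
  let ?D = "distr (measure_pmf P) (euclid n) pt"
  have "supp n ?D \<subseteq> pt ` set_pmf P"
  proof
    fix x assume x: "x \<in> supp n ?D"
    show "x \<in> pt ` set_pmf P"
    proof (rule ccontr)
      assume nin: "x \<notin> pt ` set_pmf P"
      define d where "d = Min ((\<lambda>i. l2_dist n x (pt i)) ` set_pmf P)"
      have d_le: "d \<le> l2_dist n x (pt i)" if "i \<in> set_pmf P" for i
        unfolding d_def using fin that by (intro Min_le) auto
      have "d > 0"
        unfolding d_def using fin nin x pt set_pmf_not_empty[of P]
        by (auto simp: Min_gr_iff supp_def intro!: l2_dist_pos)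
      then have "measure ?D {y \<in> space (euclid n). l2_dist n x y < d} > 0"
        using x by (simp add: supp_def)
      also have "measure ?D {y \<in> space (euclid n). l2_dist n x y < d} = measure P {i. l2_dist n x (pt i) < d}"
        using pt by (subst measure_distr[OF _ open_ball_measurable]) (auto intro!: arg_cong[where f = "measure P"])
      also have "\<dots> = 0"
        unfolding measure_pmf_zero_iff using d_le by (auto simp: not_less[symmetric])
      finally show False by simp
    qed
  qed
  moreover have "pt ` set_pmf P \<subseteq> (\<Union>j<k. unit_ball n (c j))" using cover by auto
  ultimately have "supp n ?D \<subseteq> (\<Union>j<k. unit_ball n (c j))" by (rule order_trans)
  then show ?thesis
    using c distribution_on_distr[OF pt] unfolding clusterable_def
    by (intro conjI exI[of _ c]) simp_all
qed

text \<open>The set \<open>S\<close> of atoms missed by the balls witnesses the distance. Each of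
  its points lies outside the support of \<open>D'\<close> and so has a null neighbourhood; as
  \<open>S\<close> is finite, \<open>D'\<close> gives it mass 0.\<close>

lemma far_from_clusterable_discrete:
  assumes pt: "\<And>i. pt i \<in> space (euclid n)" and fin: "finite (set_pmf P)"
    and uncov: "\<And>c. measure P {i. \<forall>j<k. pt i \<notin> unit_ball n (c j)} \<ge> \<epsilon>"
  shows "far_from_clusterable n k \<epsilon> (distr (measure_pmf P) (euclid n) pt)"
  unfolding far_from_clusterable_def
proof (intro conjI allI impI)
  let ?D = "distr (measure_pmf P) (euclid n) pt"
  show D: "distribution_on n ?D" by (rule distribution_on_distr[OF pt])
  fix D' assume D': "clusterable n k D'"
  then obtain c where c: "supp n D' \<subseteq> (\<Union>j<k. unit_ball n (c j))"
    and sets: "sets D' = sets (euclid n)" and prob: "prob_space D'"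
    by (auto simp: clusterable_def distribution_on_def)
  interpret D': prob_space D' by fact
  interpret D: prob_space ?D using D by (simp add: distribution_on_def)
  define S where "S = {pt i | i. i \<in> set_pmf P \<and> (\<forall>j<k. pt i \<notin> unit_ball n (c j))}"
  have finS: "finite S" unfolding S_def using fin by auto
  have Ssub: "s \<in> space (euclid n)" if "s \<in> S" for s using that pt by (auto simp: S_def)
  have Ssets: "{s} \<in> sets (euclid n)" if "s \<in> S" for s using singleton_measurable Ssub that by blast
  have "S = (\<Union>s\<in>S. {s})" by simp
  then have S_meas: "S \<in> sets (euclid n)" using finS Ssets by (metis sets.finite_UN)
  have "measure D' {s} = 0" if s: "s \<in> S" for s
  proof -
    have "s \<notin> supp n D'" using c s by (auto simp: S_def)
    then obtain r where r: "r > 0" "\<not> measure D' {y \<in> space (euclid n). l2_dist n s y < r} > 0"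
      using Ssub[OF s] by (auto simp: supp_def)
    have "measure D' {s} \<le> measure D' {y \<in> space (euclid n). l2_dist n s y < r}"
      using r Ssub[OF s] open_ball_measurable sets
      by (intro D'.finite_measure_mono) (auto simp: l2_dist_def L2_set_def)
    then show ?thesis using r measure_nonneg[of D' "{s}"] by linarith
  qed
  then have D'S: "measure D' S = 0"
    using D'.finite_measure_eq_sum_singleton[OF finS] Ssets sets by simp
  have "\<epsilon> \<le> measure P {i. \<forall>j<k. pt i \<notin> unit_ball n (c j)}" by (rule uncov)
  also have "\<dots> = measure P ({i. \<forall>j<k. pt i \<notin> unit_ball n (c j)} \<inter> set_pmf P)"
    by (simp add: measure_Int_set_pmf)
  also have "\<dots> \<le> measure P (pt -` S)"
    by (intro measure_pmf.finite_measure_mono) (auto simp: S_def)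
  also have "\<dots> = measure ?D S" using pt S_meas by (subst measure_distr) auto
  also have "\<dots> = \<bar>measure ?D S - measure D' S\<bar>" using D'S by simp
  also have "\<dots> \<le> tv_dist ?D D'"
    unfolding tv_dist_def
  proof (rule cSUP_upper)
    show "S \<in> sets ?D" using S_meas by simp
    have "\<bar>measure ?D A - measure D' A\<bar> \<le> 1" for A
      using D.prob_le_1[of A] D'.prob_le_1[of A] measure_nonneg[of ?D A] measure_nonneg[of D' A]
      by linarith
    then show "bdd_above ((\<lambda>A. \<bar>measure ?D A - measure D' A\<bar>) ` sets ?D)" by (intro bdd_aboveI[of _ 1]) auto
  qed
  finally show "\<epsilon> \<le> tv_dist ?D D'" .
qed

subsection \<open>The lower bound\<close>

lemma expectation_sum_Pi_pmf:
  fixes g :: "'b \<Rightarrow> real"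
  assumes J: "finite J" and p: "finite (set_pmf p)"
  shows "measure_pmf.expectation (Pi_pmf J d (\<lambda>_. p)) (\<lambda>f. \<Sum>i\<in>J. g (f i))
    = card J * measure_pmf.expectation p g"
proof -
  have int: "integrable (Pi_pmf J d (\<lambda>_. p)) h" for h :: "_ \<Rightarrow> real"
    by (intro integrable_measure_pmf_finite finite_set_Pi_pmf J p)
  have "measure_pmf.expectation (Pi_pmf J d (\<lambda>_. p)) (\<lambda>f. g (f i)) = measure_pmf.expectation p g"
    if "i \<in> J" for i
  proof -
    have "measure_pmf.expectation (Pi_pmf J d (\<lambda>_. p)) (\<lambda>f. g (f i))
        = measure_pmf.expectation (map_pmf (\<lambda>f. f i) (Pi_pmf J d (\<lambda>_. p))) g"
      by simp
    then show ?thesis using that J by (simp add: Pi_pmf_component)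
  qed
  then show ?thesis by (subst Bochner_Integration.integral_sum) (auto simp: int)
qed

text \<open>Turns rejection with probability at least 2/3 into acceptance with probability at most
  1/3.\<close>

lemma output_law_le_1:
  assumes T: "randomized_alg n m T" and D: "distribution_on n D"
  shows "measure (output_law m T D) {True} + measure (output_law m T D) {False} \<le> 1"
proof -
  have "prob_space (PiM {..<m} (\<lambda>_. D))"
    using D by (intro prob_space_PiM) (simp add: distribution_on_def)
  then interpret PD: prob_space "PiM {..<m} (\<lambda>_. D)" .
  have T': "T \<in> measurable (PiM {..<m} (\<lambda>_. euclid n)) (subprob_algebra (count_space UNIV))"
    using T unfolding randomized_alg_def by (rule measurable_prob_algebraD)
  have "sets (PiM {..<m} (\<lambda>_. D)) = sets (PiM {..<m} (\<lambda>_. euclid n))"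
    using D by (intro sets_PiM_cong) (auto simp: distribution_on_def)
  then have TD: "T \<in> measurable (PiM {..<m} (\<lambda>_. D)) (subprob_algebra (count_space UNIV))"
    using T' measurable_cong_sets by blast
  interpret O: subprob_space "output_law m T D"
    unfolding output_law_def using PD.subprob_space_axioms TD by (rule subprob_space_bind)
  have sets: "sets (output_law m T D) = UNIV"
    unfolding output_law_def by (subst sets_bind[OF _ PD.not_empty, where N = "count_space UNIV"])
      (use TD in \<open>auto dest: subprob_measurableD\<close>)
  have "measure (output_law m T D) ({True} \<union> {False})
      = measure (output_law m T D) {True} + measure (output_law m T D) {False}"
    by (rule O.finite_measure_Union) (auto simp: sets)
  then show ?thesis using O.subprob_measure_le_1[of "{True} \<union> {False}"] by simp
qed

text \<open>
  Replacing the probability that a prior yields an admissible distribution by a linear lower (or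
  upper) bound on the acceptance probability makes Markov's inequality implicit.
\<close>

lemma tester_separates_priors:
  assumes n: "n \<ge> 1" and k: "k \<ge> 1" and T: "is_tester n k \<epsilon> m T" and \<epsilon>: "\<epsilon> \<le> 1 / 4000"
    and p: "finite (set_pmf p)" "pmf p 0 \<ge> 1 - 1 / 8000"
    and q: "finite (set_pmf q)" "0 \<notin> set_pmf q" "measure_pmf.expectation q real \<le> 7"
  defines "M \<equiv> 4 * n * (k - k div 20)"
  shows "\<exists>F. (\<forall>x. 0 \<le> F x \<and> F x \<le> 1) \<and>
    measure_pmf.expectation (Pi_pmf {..<M} 0 (\<lambda>_. p)) (\<lambda>f. sample_mean m {..M} F (weights M f))
    - measure_pmf.expectation (Pi_pmf {..<M} 0 (\<lambda>_. q)) (\<lambda>f. sample_mean m {..M} F (weights M f)) \<ge> 1 / 4"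
proof -
  have alg: "randomized_alg n m T" using T by (simp add: is_tester_def)
  obtain pt :: "nat \<Rightarrow> nat \<Rightarrow> real" where pt: "\<And>i. pt i \<in> space (euclid n)"
    and cover: "\<forall>A. A \<subseteq> {..<M} \<and> 20 * card A \<le> n * k \<longrightarrow>
      (\<exists>c. (\<forall>j<k. c j \<in> space (euclid n)) \<and> (\<forall>i\<in>insert M A. \<exists>j<k. pt i \<in> unit_ball n (c j)))"
    and few: "\<forall>c. card {i. i < M \<and> (\<exists>j<k. pt i \<in> unit_ball n (c j))} \<le> 3 * n * k"
    using cluster_configuration[OF n k] unfolding M_def[symmetric] by blast
  have M_bounds: "M \<ge> 1" "M \<le> 4 * (n * k)" "5 * M \<ge> 19 * (n * k)"
  proof -
    have K: "k - k div 20 \<ge> 1" "k - k div 20 \<le> k" "20 * (k - k div 20) \<ge> 19 * k" using k by linarith+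
    show "M \<ge> 1" using n K(1) by (simp add: M_def)
    have "n * (k - k div 20) \<le> n * k" using K(2) by simp
    then show "M \<le> 4 * (n * k)" by (simp add: M_def)
    have "n * (19 * k) \<le> n * (20 * (k - k div 20))" using K(3) by (rule mult_le_mono2)
    then show "5 * M \<ge> 19 * (n * k)" by (simp add: M_def)
  qed
  have nk: "real (n * k) > 0" using n k by simp
  define total where "total f = (\<Sum>i\<le>M. weights M f i)" for f
  have total: "total f = (\<Sum>i<M. real (f i)) / real M + 1" for f
  proof -
    have "(\<Sum>i\<le>M. weights M f i) = (\<Sum>i<M. weights M f i) + weights M f M"
      unfolding lessThan_Suc_atMost[symmetric] by simp
    also have "(\<Sum>i<M. weights M f i) = (\<Sum>i<M. real (f i) / real M)"
      by (rule sum.cong) (auto simp: weights_def)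
    finally show ?thesis by (simp add: total_def weights_def sum_divide_distrib)
  qed
  have total1: "total f \<ge> 1" for f unfolding total by (simp add: sum_nonneg)
  have "\<exists>P. \<forall>i. pmf P i = (if i \<in> {..M} then weights M f i / total f else 0)" for f
    using total1[of f] unfolding total_def by (intro pmf_of_weights) (auto simp: weights_def)
  then have "\<forall>f. \<exists>P. \<forall>i. pmf P i = (if i \<in> {..M} then weights M f i / total f else 0)" by blast
  from choice[OF this] obtain P where
    "\<forall>f i. pmf (P f) i = (if i \<in> {..M} then weights M f i / total f else 0)" by blast
  then have P: "pmf (P f) i = (if i \<in> {..M} then weights M f i / total f else 0)" for f i by blast
  have setP: "set_pmf (P f) \<subseteq> {..M}" for f by (auto simp: set_pmf_iff P split: if_splits)
  have finP: "finite (set_pmf (P f))" for f by (rule finite_subset[OF setP]) simp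
  define D where "D f = distr (measure_pmf (P f)) (euclid n) pt" for f
  have D: "distribution_on n (D f)" for f unfolding D_def by (rule distribution_on_distr[OF pt])
  define F where "F x = measure (T (\<lambda>j\<in>{..<m}. pt (x j))) {True}" for x
  have F: "0 \<le> F x \<and> F x \<le> 1" for x
  proof -
    have "(\<lambda>j\<in>{..<m}. pt (x j)) \<in> space (PiM {..<m} (\<lambda>_. euclid n))"
      using pt by (auto simp: space_PiM)
    then have "T (\<lambda>j\<in>{..<m}. pt (x j)) \<in> space (prob_algebra (count_space UNIV))"
      using alg unfolding randomized_alg_def by (rule measurable_space[rotated])
    then have "prob_space (T (\<lambda>j\<in>{..<m}. pt (x j)))" by (simp add: space_prob_algebra)
    then show ?thesis by (simp add: F_def prob_space.prob_le_1)
  qed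
  define acc where "acc f = sample_mean m {..M} F (weights M f)" for f
  have acc: "acc f = measure (output_law m T (D f)) {True}" for f
    unfolding acc_def F_def D_def
    by (rule output_law_discrete[OF alg pt, symmetric]) (auto simp: P total_def)
  have acc01: "0 \<le> acc f" "acc f \<le> 1" for f
    unfolding acc
    using output_law_le_1[OF alg D, of f] measure_nonneg[of "output_law m T (D f)" "{False}"]
    by (simp, linarith)
  have clust: "acc f \<ge> 2 / 3" if f: "20 * card {i. i < M \<and> f i \<noteq> 0} \<le> n * k" for f
  proof -
    obtain c where c: "\<forall>j<k. c j \<in> space (euclid n)"
      "\<forall>i\<in>insert M {i. i < M \<and> f i \<noteq> 0}. \<exists>j<k. pt i \<in> unit_ball n (c j)"
      using cover[rule_format, of "{i. i < M \<and> f i \<noteq> 0}"] f by auto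
    have "set_pmf (P f) \<subseteq> insert M {i. i < M \<and> f i \<noteq> 0}"
      by (auto simp: set_pmf_iff P weights_def split: if_splits)
    then have "clusterable n k (D f)"
      unfolding D_def using c by (intro clusterable_discrete[OF pt finP]) auto
    then show ?thesis using T D[of f] by (simp add: acc is_tester_def)
  qed
  have far: "acc f \<le> 1 / 3" if f: "\<And>i. i < M \<Longrightarrow> f i \<noteq> 0" "(\<Sum>i<M. real (f i)) \<le> 700 * real M" for f
  proof -
    have tot: "total f \<le> 701" unfolding total using f(2) M_bounds(1) by (simp add: divide_le_eq)
    have "far_from_clusterable n k \<epsilon> (D f)"
      unfolding D_def
    proof (rule far_from_clusterable_discrete[OF pt finP])
      fix c :: "nat \<Rightarrow> nat \<Rightarrow> real"
      let ?U = "{i. \<forall>j<k. pt i \<notin> unit_ball n (c j)}"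
      \<comment> \<open>The balls cover at most 3nk points, and nk is at most 5M/19, which leaves
        4M/19 points.\<close>
      have "real M / 5 \<le> real (card ({..<M} \<inter> ?U))"
      proof -
        have "{..<M} = ({..<M} \<inter> ?U) \<union> {i. i < M \<and> (\<exists>j<k. pt i \<in> unit_ball n (c j))}" by auto
        then have "card {..<M} = card (({..<M} \<inter> ?U) \<union> {i. i < M \<and> (\<exists>j<k. pt i \<in> unit_ball n (c j))})"
          by (rule arg_cong)
        also have "\<dots> \<le> card ({..<M} \<inter> ?U) + card {i. i < M \<and> (\<exists>j<k. pt i \<in> unit_ball n (c j))}"
          by (rule card_Un_le)
        finally have "M \<le> card ({..<M} \<inter> ?U) + 3 * n * k"
          using few[rule_format, of c] by simp
        then have "real M \<le> real (card ({..<M} \<inter> ?U)) + 3 * real (n * k)" by linarith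
        moreover have "19 * real (n * k) \<le> 5 * real M" using M_bounds(3) by linarith
        ultimately show ?thesis by linarith
      qed
      then have "real M / 5 * (1 / (701 * real M)) \<le> (\<Sum>i\<in>{..<M} \<inter> ?U. 1 / (701 * real M))"
        by (simp add: mult_right_mono divide_right_mono)
      also have "\<dots> \<le> (\<Sum>i\<in>{..<M} \<inter> ?U. pmf (P f) i)"
      proof (rule sum_mono)
        fix i assume "i \<in> {..<M} \<inter> ?U"
        then have i: "i < M" by simp
        have "1 / (701 * real M) = (1 / real M) / 701" by simp
        also have "\<dots> \<le> weights M f i / total f"
          using i f(1)[OF i] tot total1[of f] by (intro frac_le) (auto simp: weights_def divide_right_mono)
        finally show "1 / (701 * real M) \<le> pmf (P f) i" using i by (simp add: P)
      qed
      also have "\<dots> = measure (P f) ({..<M} \<inter> ?U)" by (simp add: measure_measure_pmf_finite)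
      also have "\<dots> \<le> measure (P f) ?U" by (intro measure_pmf.finite_measure_mono) auto
      finally show "\<epsilon> \<le> measure (P f) ?U" using \<epsilon> M_bounds(1) by simp
    qed
    then have "measure (output_law m T (D f)) {False} \<ge> 2 / 3" using T D[of f] by (simp add: is_tester_def)
    then show ?thesis using output_law_le_1[OF alg D, of f] by (simp add: acc)
  qed
  let ?E = "measure_pmf.expectation"
  let ?P = "Pi_pmf {..<M} 0 (\<lambda>_. p)" and ?Q = "Pi_pmf {..<M} 0 (\<lambda>_. q)"
  have int: "integrable ?P h" "integrable ?Q h" for h :: "_ \<Rightarrow> real"
    by (intro integrable_measure_pmf_finite finite_set_Pi_pmf p q finite_lessThan)+
  \<comment> \<open>The expected number of nonzero weights is at most 4nk/8000, and the threshold is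
    nk/20; Markov's inequality loses 1/100.\<close>
  have EP: "?E ?P acc \<ge> 2 / 3 - 1 / 100"
  proof -
    have "2 / 3 - 20 / real (n * k) * (\<Sum>i<M. of_bool (f i \<noteq> 0)) \<le> acc f" for f
    proof -
      have X: "(\<Sum>i<M. of_bool (f i \<noteq> 0)) = real (card {i. i < M \<and> f i \<noteq> 0})"
      proof -
        have "{..<M} \<inter> {i. f i \<noteq> 0} = {i. i < M \<and> f i \<noteq> 0}" by auto
        then show ?thesis by (simp add: sum_of_bool_eq)
      qed
      show ?thesis
      proof (cases "20 * card {i. i < M \<and> f i \<noteq> 0} \<le> n * k")
        case True
        have "20 / real (n * k) * (\<Sum>i<M. of_bool (f i \<noteq> 0)) \<ge> 0" by (simp add: sum_nonneg)
        then show ?thesis using clust[OF True] by linarith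
      next
        case False
        then have "real (n * k) \<le> 20 * real (card {i. i < M \<and> f i \<noteq> 0})" by linarith
        then have "1 \<le> 20 / real (n * k) * (\<Sum>i<M. of_bool (f i \<noteq> 0))"
          unfolding X using nk by (simp add: pos_le_divide_eq)
        then show ?thesis using acc01(1)[of f] by linarith
      qed
    qed
    then have "?E ?P (\<lambda>f. 2 / 3 - 20 / real (n * k) * (\<Sum>i<M. of_bool (f i \<noteq> 0))) \<le> ?E ?P acc"
      by (intro integral_mono int) auto
    also have "?E ?P (\<lambda>f. 2 / 3 - 20 / real (n * k) * (\<Sum>i<M. of_bool (f i \<noteq> 0)))
        = 2 / 3 - 20 / real (n * k) * ?E ?P (\<lambda>f. \<Sum>i<M. of_bool (f i \<noteq> 0))"
      by (subst Bochner_Integration.integral_diff) (auto simp: int)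
    also have "?E ?P (\<lambda>f. \<Sum>i<M. of_bool (f i \<noteq> 0)) = real M * ?E p (\<lambda>x. of_bool (x \<noteq> 0))"
      using expectation_sum_Pi_pmf[OF _ p(1), of "{..<M}" 0 "\<lambda>x. of_bool (x \<noteq> 0)"] by simp
    also have "?E p (\<lambda>x. of_bool (x \<noteq> 0)) = 1 - pmf p 0"
    proof -
      have "?E p (\<lambda>x. of_bool (x \<noteq> 0)) = ?E p (\<lambda>x. 1 - indicator {0} x)"
        by (rule Bochner_Integration.integral_cong) (auto split: split_indicator)
      also have "\<dots> = 1 - pmf p 0"
        by (subst Bochner_Integration.integral_diff) (auto simp: integrable_measure_pmf_finite p measure_pmf_single)
      finally show ?thesis .
    qed
    finally have "2 / 3 - 20 / real (n * k) * (real M * (1 - pmf p 0)) \<le> ?E ?P acc" .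
    moreover have "20 / real (n * k) * (real M * (1 - pmf p 0)) \<le> 20 / real (n * k) * (4 * real (n * k) * (1 / 8000))"
      using M_bounds(2) p(2) pmf_le_1[of p 0] by (intro mult_left_mono mult_mono) (auto simp flip: of_nat_mult)
    moreover have "20 / real (n * k) * (4 * real (n * k) * (1 / 8000)) = 1 / 100" using n k by simp
    ultimately show ?thesis by linarith
  qed
  \<comment> \<open>The mean 7 against the threshold 700 loses another 1/100.\<close>
  have EQ: "?E ?Q acc \<le> 1 / 3 + 1 / 100"
  proof -
    have pw: "acc f \<le> 1 / 3 + 1 / (700 * real M) * (\<Sum>i<M. real (f i))" if "f \<in> set_pmf ?Q" for f
    proof (cases "(\<Sum>i<M. real (f i)) \<le> 700 * real M")
      case True
      have "f i \<noteq> 0" if "i < M" for i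
        using \<open>f \<in> set_pmf ?Q\<close> q(2) that by (auto simp: set_Pi_pmf PiE_dflt_def)
      then have "acc f \<le> 1 / 3" using far True by blast
      moreover have "1 / (700 * real M) * (\<Sum>i<M. real (f i)) \<ge> 0" by (simp add: sum_nonneg)
      ultimately show ?thesis by linarith
    next
      case False
      then have "1 \<le> 1 / (700 * real M) * (\<Sum>i<M. real (f i))" using M_bounds(1) by simp
      then show ?thesis using acc01(2)[of f] by linarith
    qed
    have "?E ?Q acc \<le> ?E ?Q (\<lambda>f. 1 / 3 + 1 / (700 * real M) * (\<Sum>i<M. real (f i)))"
      by (intro integral_mono_AE int, unfold AE_measure_pmf_iff) (rule ballI, rule pw)
    also have "\<dots> = 1 / 3 + 1 / (700 * real M) * ?E ?Q (\<lambda>f. \<Sum>i<M. real (f i))"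
      by (subst Bochner_Integration.integral_add) (auto simp: int)
    also have "?E ?Q (\<lambda>f. \<Sum>i<M. real (f i)) = real M * ?E q real"
      using expectation_sum_Pi_pmf[OF _ q(1), of "{..<M}" 0 real] by simp
    also have "1 / (700 * real M) * (real M * ?E q real) = ?E q real / 700"
      using M_bounds(1) by simp
    finally show ?thesis using q(3) by simp
  qed
  show ?thesis
    using EP EQ F unfolding acc_def by (intro exI[of _ F]) auto
qed

text \<open>The bound \<open>m \<noteq> 0\<close> serves the small values of nk, for which the range
  of the priors is too large compared with \<open>M\<close>.\<close>

lemma tester_sample_complexity:
  assumes n: "n \<ge> 1" and k: "k \<ge> 1" and T: "is_tester n k \<epsilon> m T" and \<epsilon>: "\<epsilon> \<le> 1 / 4000" and r: "r \<ge> 1"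
  defines "M \<equiv> 4 * n * (k - k div 20)" and "b \<equiv> 160004 * r\<^sup>2"
  shows "m \<noteq> 0" and "4 * b \<le> M \<Longrightarrow> 1 / 4 \<le> real M * (2 * exp (8 * real m * real b / real M) * (1/2) ^ r)"
proof -
  obtain p q :: "nat pmf" and S where S: "S \<subseteq> {..b}" "set_pmf p \<subseteq> S" "set_pmf q \<subseteq> S"
    and mom: "\<forall>k\<le>r. (\<Sum>x\<in>S. (pmf p x - pmf q x) * real x ^ k) = 0"
    and p0: "pmf p 0 \<ge> 1 - 1 / 8000" and q0: "0 \<notin> set_pmf q" and q7: "(\<Sum>x\<in>S. real x * pmf q x) \<le> 7"
    using moment_matching_priors[OF r] unfolding b_def by blast
  have finS: "finite S" using S(1) finite_subset by blast
  have fin: "finite (set_pmf p)" "finite (set_pmf q)" 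
    using finite_subset[OF S(2) finS] finite_subset[OF S(3) finS] .
  have Eq: "measure_pmf.expectation q real \<le> 7"
  proof -
    have "measure_pmf.expectation q real = (\<Sum>x\<in>S. real x * pmf q x)"
      by (rule integral_measure_pmf_real[OF finS]) (use S(3) in auto)
    then show ?thesis using q7 by simp
  qed
  obtain F where F: "\<forall>x. 0 \<le> F x \<and> F x \<le> 1" and sep:
    "measure_pmf.expectation (Pi_pmf {..<M} 0 (\<lambda>_. p)) (\<lambda>f. sample_mean m {..M} F (weights M f))
    - measure_pmf.expectation (Pi_pmf {..<M} 0 (\<lambda>_. q)) (\<lambda>f. sample_mean m {..M} F (weights M f)) \<ge> 1 / 4"
    using tester_separates_priors[OF n k T \<epsilon> fin(1) p0 fin(2) q0 Eq] unfolding M_def by blast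
  show "m \<noteq> 0"
  proof
    assume "m = 0"
    \<comment> \<open>Without samples the mean is the value of \<open>F\<close> at the empty tuple,
      whatever the weights.\<close>
    then show False using sep by (simp add: sample_mean_def)
  qed
  assume b4: "4 * b \<le> M"
  have "b \<ge> 1" using r by (simp add: b_def)
  then have "M \<ge> 1" using b4 by linarith
  from sample_mean_indistinguishable[OF this \<open>b \<ge> 1\<close> b4 S, of r F m] mom F sep
  show "1 / 4 \<le> real M * (2 * exp (8 * real m * real b / real M) * (1/2) ^ r)"
    by force
qed

theorem theorem1p3:
  "\<exists>\<epsilon>\<^sub>0::real. \<exists>c::real. \<epsilon>\<^sub>0 > 0 \<and> c > 0 \<and>
     (\<forall>\<epsilon> n k m T. 0 < \<epsilon> \<and> \<epsilon> < \<epsilon>\<^sub>0 \<and> n > 0 \<and> k > 0 \<and> n * k \<ge> 2 \<and> is_tester n k \<epsilon> m T \<longrightarrow>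
        real m \<ge> c * (real (n * k) / ln (real (n * k))))"
proof -
  have "eventually (\<lambda>x::real. 4 * 160004 * (42 * ln x)\<^sup>2 \<le> 3.8 * x) at_top" by real_asymp
  then obtain X0 :: real where X0: "\<And>x. x \<ge> X0 \<Longrightarrow> 4 * 160004 * (42 * ln x)\<^sup>2 \<le> 3.8 * x"
    by (auto simp: eventually_at_top_linorder)
  define X where "X = max X0 1"
  \<comment> \<open>The first term serves x = nk at least \<open>X\<close>. For 2 \<le> x < X, the
    second makes c x / ln x at most 1, so \<open>m \<noteq> 0\<close> suffices.\<close>
  define c :: real where "c = min (1 / (400 * 160004)) (ln 2 / X)"
  have X: "X \<ge> 1" "X \<ge> X0" by (auto simp: X_def)
  have c: "c > 0" using X by (simp add: c_def)
  have c_le: "c \<le> 1 / (400 * 160004)" "c \<le> ln 2 / X"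
    unfolding c_def by (rule min.cobounded1, rule min.cobounded2)
  have bound: "real m \<ge> c * (real (n * k) / ln (real (n * k)))"
    if as: "\<epsilon> < 1 / 4000" "n > 0" "k > 0" "n * k \<ge> 2" "is_tester n k \<epsilon> m T" for \<epsilon> n k m T
  proof -
    define x where "x = real (n * k)"
    have n: "n \<ge> 1" and k: "k \<ge> 1" and \<epsilon>: "\<epsilon> \<le> 1 / 4000" using as by auto
    have x2: "x \<ge> 2" using as(4) unfolding x_def by linarith
    then have "ln 2 \<le> ln x" by simp
    then have lnx: "ln x \<ge> 2 / 3" using ln2_ge_two_thirds by linarith
    have m: "m \<noteq> 0" using tester_sample_complexity(1)[OF n k as(5) \<epsilon>, of 1] by simp
    show ?thesis
      unfolding x_def[symmetric]
    proof (cases "x \<ge> X")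
      case False
      have "c * (x / ln x) \<le> ln 2 / X * (X / ln 2)"
        using c_le c False X x2 by (intro mult_mono frac_le) auto
      also have "\<dots> = 1" using X by simp
      also have "1 \<le> real m" using m by simp
      finally show "c * (x / ln x) \<le> real m" .
    next
      case True
      \<comment> \<open>The final exponent (1/4 - 2/3) r = -5r/12 must be at most -ln x - 8, so as
        to beat the factor 8x and leave less than 1/4. The summand 20 secures the 8, since 100/12 >
        8.\<close>
      define r where "r = nat \<lceil>10 * ln x\<rceil> + 20"
      define M where "M = 4 * n * (k - k div 20)"
      define b where "b = 160004 * r\<^sup>2"
      have r_ge: "real r \<ge> 10 * ln x + 20" unfolding r_def by linarith
      have "real r \<le> 10 * ln x + 21" unfolding r_def using lnx by linarith
      then have r_le: "real r \<le> 42 * ln x" using lnx by linarith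
      have r1: "r \<ge> 1" by (simp add: r_def)
      have M: "real M \<ge> 3.8 * x" "real M \<le> 4 * x"
      proof -
        have K: "k - k div 20 \<le> k" "20 * (k - k div 20) \<ge> 19 * k" by linarith+
        have "n * (k - k div 20) \<le> n * k" using K(1) by simp
        then have "M \<le> 4 * (n * k)" by (simp add: M_def)
        then show "real M \<le> 4 * x" unfolding x_def by linarith
        have "n * (19 * k) \<le> n * (20 * (k - k div 20))" using K(2) by (rule mult_le_mono2)
        then have "19 * (n * k) \<le> 5 * M" by (simp add: M_def)
        then show "real M \<ge> 3.8 * x" unfolding x_def by linarith
      qed
      have "real (4 * b) = 4 * 160004 * (real r)\<^sup>2" by (simp add: b_def)
      also have "\<dots> \<le> 4 * 160004 * (42 * ln x)\<^sup>2"
        using r_le by (intro mult_left_mono power_mono) auto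
      also have "\<dots> \<le> 3.8 * x" using X0 True X by auto
      also have "\<dots> \<le> real M" by (rule M)
      finally have b4: "4 * b \<le> M" by linarith
      show "c * (x / ln x) \<le> real m"
      proof (rule ccontr)
        assume "\<not> c * (x / ln x) \<le> real m"
        then have "real m \<le> c * (x / ln x)" by simp
        also have "\<dots> \<le> 1 / (400 * 160004) * (x / ln x)"
          using c_le x2 lnx by (intro mult_right_mono) auto
        finally have "real m * ln x \<le> x / (400 * 160004)" using lnx by (simp add: field_simps)
        moreover have "real m * real r \<le> real m * (42 * ln x)" using r_le by (intro mult_left_mono) auto
        \<comment> \<open>Here 32 * 42 / 400 = 3.36 stays below 3.8; this is the origin of the 400
          in \<open>c\<close>.\<close>
        ultimately have mr: "32 * 160004 * (real m * real r) \<le> real M" using M x2 by simp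
        have "8 * real m * real b = (32 * 160004 * (real m * real r)) * (real r / 4)"
          by (simp add: b_def power2_eq_square)
        also have "\<dots> \<le> real M * (real r / 4)" using mr by (intro mult_right_mono) auto
        finally have expo: "8 * real m * real b / real M \<le> real r / 4"
          using M x2 by (simp add: divide_le_eq mult.commute)
        have half: "(1/2 :: real) ^ r \<le> exp (- (2 / 3) * real r)"
        proof -
          have "exp (- ln 2 * real r) = exp (- ln 2) ^ r"
            by (simp only: exp_of_nat_mult mult.commute[of _ "real r"])
          also have "exp (- ln 2) = (1/2 :: real)" by (simp add: exp_minus)
          finally have "(1/2 :: real) ^ r = exp (- ln 2 * real r)" by (rule sym)
          also have "\<dots> \<le> exp (- (2 / 3) * real r)"
            using mult_right_mono[OF ln2_ge_two_thirds, of "real r"] by simp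
          finally show ?thesis .
        qed
        have "1 / 4 \<le> real M * (2 * exp (8 * real m * real b / real M) * (1/2) ^ r)"
          using tester_sample_complexity(2)[OF n k as(5) \<epsilon> r1] b4 unfolding M_def b_def by blast
        also have "\<dots> \<le> (4 * x) * (2 * exp (real r / 4) * exp (- (2 / 3) * real r))"
          using M expo half x2 by (intro mult_mono) auto
        also have "\<dots> = 8 * x * exp (real r / 4 + - (2 / 3) * real r)"
          unfolding exp_add by simp
        also have "\<dots> \<le> 8 * x * exp (- ln x - 8)"
          using x2 r_ge lnx by (intro mult_left_mono) auto
        also have "exp (- ln x - 8) = exp (- 8) / x"
          using x2 by (simp add: exp_diff exp_minus field_simps)
        also have "8 * x * (exp (- 8) / x) = 8 * exp (- 8)" using x2 by simp
        also have "exp (- 8 :: real) < 1 / 32"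
        proof -
          have "(2 :: real) ^ 8 \<le> exp 1 ^ 8" using exp_ge_add_one_self[of 1] by (intro power_mono) auto
          also have "exp 1 ^ 8 = exp (8 :: real)" by (simp add: exp_of_nat_mult[symmetric])
          finally show ?thesis by (simp add: exp_minus field_simps)
        qed
        finally show False by simp
      qed
    qed
  qed
  show ?thesis
    by (rule exI[of _ "1 / 4000"], rule exI[of _ c]) (use bound c in auto)
qed

end
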